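(* Let $R$ be the continuous-time random walk in the quarter plane with homogeneous rates $q_{i,j},h_{i,j},v_{i,j},r_{i,j}$ and let $\bar\pi(n_1,n_2)=\sum_{k=1}^K c_k\rho_k^{n_1}\sigma_k^{n_2}$ be a probability distribution on $S$ that is a sum of geometric terms satisfying the interior balance equation of $R$. Suppose that the transition rates of $\bar R$ are obtained by the single direction inhomogeneous construction (see context), and that the constants $\bar h_{1,0},\bar v_{0,1}\ge 0$ are chosen such that $$\bar h_{-1,0}(n_1,0)\ge h_{-1,0},\qquad \bar v_{0,-1}(0,n_2)\ge v_{0,-1},\qquad\forall\, n_1,n_2=1,2,\dots.$$ Let $F:S\to[0,\infty)$ be a reward function, with expected stationary rewards $\mathcal F=\sum_{(n_1,n_2)\in S}\pi(n_1,n_2)F(n_1,n_2)$ and $\bar{\mathcal F}=\sum_{(n_1,n_2)\in S}\bar\pi(n_1,n_2)F(n_1,n_2)$, where $\pi$ is the stationary probability distribution of $R$, and let $D^t_{i,j}$ be the bias terms defined in the context. Assume that there are an integer $M\ge0$, real numbers $b_{1,m},b_{2,m}$ ($0\le m\le M$) and $B_3$ such that, with $B_1(n_1,0)=\sum_{m=0}^Mb_{1,m}n_1^m$ and $B_2(0,n_2)=\sum_{m=0}^Mb_{2,m}n_2^m$, for all integers $t\ge0$ and all $n_1,n_2\ge1$, $$|D^t_{i,j}(n_1,0)|\le B_1(n_1,0)\ \ \forall(i,j)\in N_1,\qquad |D^t_{i,j}(0,n_2)|\le B_2(0,n_2)\ \ \forall(i,j)\in N_2,\qquad |D^t_{i,j}(0,0)|\le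 B_3\ \ \forall(i,j)\in N_3.$$ Then $$\left|\bar{\mathcal F}-\mathcal F\right|\le g^{(1)}+g^{(2)}+g^{(3)},$$ where $$g^{(1)}=\left(\delta_h+|\bar h_{1,0}-h_{1,0}|-h_{-1,0}\right)\sum_{k=1}^K\sum_{m=0}^Mc_kb_{1,m}\mathrm{Li}_{-m}(\rho_k)+\bar h_{1,0}\sum_{k=1}^K\sum_{m=0}^Mc_k\rho_k^{-1}b_{1,m}\mathrm{Li}_{-m}(\rho_k)-\sum_{k=1}^K\sum_{m=0}^Mc_k\alpha_kb_{1,m}(1-\rho_k)^{-1}\mathrm{Li}_{-m}(\rho_k),$$ $$g^{(2)}=\left(\delta_v+|\bar v_{0,1}-v_{0,1}|-v_{0,-1}\right)\sum_{k=1}^K\sum_{m=0}^Mc_kb_{2,m}\mathrm{Li}_{-m}(\sigma_k)+\bar v_{0,1}\sum_{k=1}^K\sum_{m=0}^Mc_k\sigma_k^{-1}b_{2,m}\mathrm{Li}_{-m}(\sigma_k)-\sum_{k=1}^K\sum_{m=0}^Mc_k\beta_kb_{2,m}(1-\sigma_k)^{-1}\mathrm{Li}_{-m}(\sigma_k),$$ $$g^{(3)}=\delta_rB_3\sum_{k=1}^Kc_k.$$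
   Context: State space and components: $S=\{0,1,2,\dots\}^2$; $S_1=\{1,2,\dots\}\times\{0\}$, $S_2=\{0\}\times\{1,2,\dots\}$, $S_3=\{(0,0)\}$, $S_4=\{1,2,\dots\}^2$. Possible transitions: $N_1=(\{-1,0,1\}\times\{0,1\})\setminus\{(0,0)\}$, $N_2=(\{0,1\}\times\{-1,0,1\})\setminus\{(0,0)\}$, $N_3=(\{0,1\}\times\{0,1\})\setminus\{(0,0)\}$, $N_4=(\{-1,0,1\}\times\{-1,0,1\})\setminus\{(0,0)\}$. For $(n_1,n_2)\in S$, $N(n_1,n_2)=\{(i,j)\in\{-1,0,1\}^2 : (i,j)\ne(0,0),\ (n_1+i,n_2+j)\in S\}$ (equal to $N_m$ on $S_m$). The walk $R$: a continuous-time random walk on $S$ whose transition rate $q_{i,j}(n_1,n_2)$ from $(n_1,n_2)$ to $(n_1+i,n_2+j)$, $(i,j)\in N(n_1,n_2)$, is a nonnegative constant $h_{i,j}$, $v_{i,j}$, $r_{i,j}$, $q_{i,j}$ according to whether $(n_1,n_2)$ lies in $S_1,S_2,S_3,S_4$. $R$ is assumed irreducible, aperiodic and positive recurrent, with stationary probability distribution $\pi$. Put $q_{0,0}=-\sum_{(i,j)\in N_4}q_{i,j}$. Sum of geometric terms satisfying the interior balance equation: $c_k\in\mathbb R$, $(\rho_k,\sigma_k)\in(0,1)^2$ for $k=1,\dots,K$, the function $\bar\pi(n_1,n_2)=\sum_{k=1}^K c_k\rho_k^{n_1}\sigma_k^{n_2}$ is a probability distribution on $S$, and for each $k$ the single-term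 measure $\rho_k^{n_1}\sigma_k^{n_2}$ satisfies the interior balance equation, i.e. $\sum_{i=-1}^1\sum_{j=-1}^1\rho_k^{-i}\sigma_k^{-j}q_{i,j}=0$. Single direction inhomogeneous construction: $\bar R$ is the walk on $S$ with the following rates ($\bar q_{i,j}(n_1,n_2)$, written $\bar h_{i,j}(n_1,0)$ on $S_1$, $\bar v_{i,j}(0,n_2)$ on $S_2$, $\bar r_{i,j}$ at the origin), for chosen constants $\bar h_{1,0},\bar v_{0,1}\ge0$: $\bar q_{i,j}(n_1,n_2)=q_{i,j}$ on $S_4$; $\bar h_{i,1}(n_1,0)=\bar h_{i,1}:=q_{i,1}$, $\bar v_{1,j}(0,n_2)=\bar v_{1,j}:=q_{1,j}$ for $i,j\in\{-1,0,1\}$; $\bar r_{1,0}=\bar h_{1,0}$, $\bar r_{0,1}=\bar v_{0,1}$, $\bar r_{1,1}=q_{1,1}$; $\bar h_{1,0}(n_1,0)=\bar h_{1,0}$, $\bar v_{0,1}(0,n_2)=\bar v_{0,1}$; and for $n_1,n_2\ge1$ $$\bar h_{-1,0}(n_1,0)=\frac{\sum_{k}c_k\rho_k^{n_1-1}}{\sum_{k}c_k\rho_k^{n_1}}\bar h_{1,0}-\frac{\sum_{k}c_k\alpha_k(1-\rho_k)^{-1}\rho_k^{n_1}}{\sum_{k}c_k\rho_k^{n_1}},\quad \bar v_{0,-1}(0,n_2)=\frac{\sum_{k}c_k\sigma_k^{n_2-1}}{\sum_{k}c_k\sigma_k^{n_2}}\bar v_{0,1}-\frac{\sum_{k}c_k\beta_k(1-\sigma_k)^{-1}\sigma_k^{n_2}}{\sum_{k}c_k\sigma_k^{n_2}},$$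 where sums run over $k=1,\dots,K$ and $\alpha_k=\sum_{i=-1}^1q_{i,1}-\sum_{i=-1}^1\rho_k^{-i}\sigma_kq_{i,-1}$, $\beta_k=\sum_{j=-1}^1q_{1,j}-\sum_{j=-1}^1\rho_k\sigma_k^{-j}q_{-1,j}$. Uniformization and bias terms: $R$ and $\bar R$ are uniformizable, i.e. there is $0<\gamma<\infty$ with $\sum_{(i,j)\in N(n_1,n_2)}q_{i,j}(n_1,n_2)\le\gamma$ and $\sum_{(i,j)\in N(n_1,n_2)}\bar q_{i,j}(n_1,n_2)\le\gamma$ for all $(n_1,n_2)\in S$; fix such a $\gamma$. Let $p_{i,j}(n_1,n_2)=\gamma^{-1}q_{i,j}(n_1,n_2)$ for $(i,j)\in N(n_1,n_2)$ and $p_{0,0}(n_1,n_2)=1-\gamma^{-1}\sum_{(i,j)\in N(n_1,n_2)}q_{i,j}(n_1,n_2)$ be the transition probabilities of the uniformized discrete-time chain of $R$. The reward $F$ is taken as the one-step reward of this chain, and $F^t(n_1,n_2)$ is the expected cumulative reward up to time $t$ starting from $(n_1,n_2)$ at time $0$: $F^0=0$ and, for $t\ge1$, $$F^t(n_1,n_2)=F(n_1,n_2)+\sum_{(i,j)\in N(n_1,n_2)\cup\{(0,0)\}}p_{i,j}(n_1,n_2)F^{t-1}(n_1+i,n_2+j)$$ (so that, under the ergodicity condition, $\lim_{t\to\infty}F^t(n_1,n_2)/t=\mathcal F$). The bias terms are $D^t_{i,j}(n_1,n_2)=F^t(n_1+i,n_2+j)-F^t(n_1,n_2)$. Notation: $\delta_h=\sum_{i=-1}^1|\bar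 h_{i,1}-h_{i,1}|$, $\delta_v=\sum_{j=-1}^1|\bar v_{1,j}-v_{1,j}|$, $\delta_r=\sum_{(i,j)\in N_3}|\bar r_{i,j}-r_{i,j}|$; $\mathrm{Li}_s(z)=\sum_{k=1}^\infty z^k/k^s$ is the polylogarithm.
   Formalization: The uniformization constant γ is assumed to be at least 1 (the argument gives the bound divided by γ, and the stated bound fails for small γ), and the denominators in the rates h̄_{-1,0}(n,0), v̄_{0,-1}(0,n) are assumed nonzero. *)

theory Defs
  imports "HOL-Analysis.Analysis"
begin

type_synonym state = "nat \<times> nat"
type_synonym step = "int \<times> int"

definition N1 :: "step set" where
  "N1 = ({-1, 0, 1} \<times> {0, 1}) - {(0, 0)}"

definition N2 :: "step set" where
  "N2 = ({0, 1} \<times> {-1, 0, 1}) - {(0, 0)}"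

definition N3 :: "step set" where
  "N3 = ({0, 1} \<times> {0, 1}) - {(0, 0)}"

definition N4 :: "step set" where
  "N4 = ({-1, 0, 1} \<times> {-1, 0, 1}) - {(0, 0)}"

definition nbr :: "state \<Rightarrow> step set" where
  "nbr x = {(i, j) \<in> N4. 0 \<le> int (fst x) + i \<and> 0 \<le> int (snd x) + j}"

lemma nbr_eq:
  "1 \<le> n \<Longrightarrow> nbr (n, 0) = N1"
  "1 \<le> n \<Longrightarrow> nbr (0, n) = N2"
  "nbr (0, 0) = N3"
  "1 \<le> m \<Longrightarrow> 1 \<le> n \<Longrightarrow> nbr (m, n) = N4"
  by (auto simp: nbr_def N1_def N2_def N3_def N4_def)

(* nat truncates only for steps leaving the quarter plane, i.e. never for
   steps in nbr x or the null step. *)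
definition move :: "state \<Rightarrow> step \<Rightarrow> state" where
  "move x d = (nat (int (fst x) + fst d), nat (int (snd x) + snd d))"

text \<open>
  A walk is given by its rates w x d from state x to state move x d; only the values
  with d in nbr x are meaningful.
\<close>

type_synonym walk = "state \<Rightarrow> step \<Rightarrow> real"

(* The rates on the axes may depend on the position along the axis. *)
definition quadrant_walk ::
  "(nat \<Rightarrow> int \<Rightarrow> int \<Rightarrow> real) \<Rightarrow> (nat \<Rightarrow> int \<Rightarrow> int \<Rightarrow> real) \<Rightarrow> (int \<Rightarrow> int \<Rightarrow> real) \<Rightarrow>
   (int \<Rightarrow> int \<Rightarrow> real) \<Rightarrow> walk" where
  "quadrant_walk h v r q x d =
    (if 1 \<le> fst x \<and> snd x = 0 then h (fst x) (fst d) (snd d)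
     else if fst x = 0 \<and> 1 \<le> snd x then v (snd x) (fst d) (snd d)
     else if x = (0, 0) then r (fst d) (snd d)
     else q (fst d) (snd d))"

definition homogeneous_walk ::
  "(int \<Rightarrow> int \<Rightarrow> real) \<Rightarrow> (int \<Rightarrow> int \<Rightarrow> real) \<Rightarrow> (int \<Rightarrow> int \<Rightarrow> real) \<Rightarrow>
   (int \<Rightarrow> int \<Rightarrow> real) \<Rightarrow> walk" where
  "homogeneous_walk h v r q = quadrant_walk (\<lambda>_. h) (\<lambda>_. v) r q"

definition exit_rate :: "walk \<Rightarrow> state \<Rightarrow> real" where
  "exit_rate w x = (\<Sum>d\<in>nbr x. w x d)"

definition nonneg_rates :: "walk \<Rightarrow> bool" where
  "nonneg_rates w \<longleftrightarrow> (\<forall>x. \<forall>d\<in>nbr x. 0 \<le> w x d)"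

definition incoming :: "state \<Rightarrow> (state \<times> step) set" where
  "incoming y = {(x, d). d \<in> nbr x \<and> move x d = y}"


subsection \<open>Irreducibility, aperiodicity, positive recurrence, stationarity\<close>

definition irreducible_walk :: "walk \<Rightarrow> bool" where
  "irreducible_walk w \<longleftrightarrow>
    (\<forall>x y. (x, y) \<in> {(x, move x d) | x d. d \<in> nbr x \<and> 0 < w x d}\<^sup>*)"

(* Entries of the n-th power of the generator of w. *)
primrec generator_power :: "walk \<Rightarrow> nat \<Rightarrow> state \<Rightarrow> state \<Rightarrow> real" where
  "generator_power w 0 x y = (if x = y then 1 else 0)"
| "generator_power w (Suc n) x y =
    (\<Sum>d\<in>nbr x. w x d * (generator_power w n (move x d) y - generator_power w n x y))"

(* The transition function P_t = exp (t Q); the series converges when the exit rates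
   are bounded. *)
definition transition_function :: "walk \<Rightarrow> real \<Rightarrow> state \<Rightarrow> state \<Rightarrow> real" where
  "transition_function w t x y = (\<Sum>n. t ^ n / fact n * generator_power w n x y)"

(* Continuous-time aperiodicity: the possible return epochs of a state do not lie in a
   lattice. Exponential sojourn times make this automatic. *)
definition aperiodic_walk :: "walk \<Rightarrow> bool" where
  "aperiodic_walk w \<longleftrightarrow>
    (\<forall>x. \<not> (\<exists>a>0. \<forall>t>0. 0 < transition_function w t x x \<longrightarrow> (\<exists>k::nat. t = real k * a)))"

(* excursion_prob w x n z: probability that the walk started in x is in z after its n-th
   jump and has not been in x after any of the jumps 1, ..., n. *)
primrec excursion_prob :: "walk \<Rightarrow> state \<Rightarrow> nat \<Rightarrow> state \<Rightarrow> real" where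
  "excursion_prob w x 0 z = (if z = x then 1 else 0)"
| "excursion_prob w x (Suc n) z =
    (if z = x then 0
     else (\<Sum>(y, d)\<in>incoming z. excursion_prob w x n y * (w y d / exit_rate w y)))"

(* Expected first return time to x: the mean sojourn times 1 / exit_rate, added over all
   visits that precede the first return. If x is left forever with positive probability
   the sum is infinite (for bounded exit rates), as it should be. *)
definition mean_return_time :: "walk \<Rightarrow> state \<Rightarrow> ennreal" where
  "mean_return_time w x =
    (\<Sum>\<^sub>\<infinity>(n, z)\<in>UNIV. ennreal (excursion_prob w x n z) / ennreal (exit_rate w z))"

definition positive_recurrent_walk :: "walk \<Rightarrow> bool" where
  "positive_recurrent_walk w \<longleftrightarrow> (\<forall>x. mean_return_time w x < \<infinity>)"

definition prob_distribution :: "(state \<Rightarrow> real) \<Rightarrow> bool" where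
  "prob_distribution p \<longleftrightarrow> (\<forall>x. 0 \<le> p x) \<and> (p has_sum 1) UNIV"

(* Global balance. *)
definition stationary_distribution :: "walk \<Rightarrow> (state \<Rightarrow> real) \<Rightarrow> bool" where
  "stationary_distribution w p \<longleftrightarrow> prob_distribution p \<and>
    (\<forall>y. p y * exit_rate w y = (\<Sum>(x, d)\<in>incoming y. p x * w x d))"


subsection \<open>Sums of geometric terms\<close>

definition geometric_sum ::
  "nat \<Rightarrow> (nat \<Rightarrow> real) \<Rightarrow> (nat \<Rightarrow> real) \<Rightarrow> (nat \<Rightarrow> real) \<Rightarrow> state \<Rightarrow> real" where
  "geometric_sum K c \<rho> \<sigma> x = (\<Sum>k=1..K. c k * \<rho> k ^ fst x * \<sigma> k ^ snd x)"

(* To be used with q 0 0 equal to minus the sum of q over N4. *)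
definition interior_balance :: "(int \<Rightarrow> int \<Rightarrow> real) \<Rightarrow> real \<Rightarrow> real \<Rightarrow> bool" where
  "interior_balance q \<rho> \<sigma> \<longleftrightarrow>
    (\<Sum>i\<in>{-1..1}. \<Sum>j\<in>{-1..1}. \<rho> powi (-i) * \<sigma> powi (-j) * q i j) = 0"

definition alpha :: "(int \<Rightarrow> int \<Rightarrow> real) \<Rightarrow> real \<Rightarrow> real \<Rightarrow> real" where
  "alpha q \<rho> \<sigma> = (\<Sum>i\<in>{-1..1}. q i 1) - (\<Sum>i\<in>{-1..1}. \<rho> powi (-i) * \<sigma> * q i (-1))"

definition beta :: "(int \<Rightarrow> int \<Rightarrow> real) \<Rightarrow> real \<Rightarrow> real \<Rightarrow> real" where
  "beta q \<rho> \<sigma> = (\<Sum>j\<in>{-1..1}. q 1 j) - (\<Sum>j\<in>{-1..1}. \<rho> * \<sigma> powi (-j) * q (-1) j)"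


subsection \<open>Single direction inhomogeneous construction\<close>

(* The rate of the step (-1,0) in (n,0), for n at least 1. *)
definition bar_h_left ::
  "nat \<Rightarrow> (nat \<Rightarrow> real) \<Rightarrow> (nat \<Rightarrow> real) \<Rightarrow> (nat \<Rightarrow> real) \<Rightarrow> (int \<Rightarrow> int \<Rightarrow> real) \<Rightarrow> real \<Rightarrow>
   nat \<Rightarrow> real" where
  "bar_h_left K c \<rho> \<sigma> q h10 n =
    (\<Sum>k=1..K. c k * \<rho> k ^ (n - 1)) / (\<Sum>k=1..K. c k * \<rho> k ^ n) * h10
    - (\<Sum>k=1..K. c k * alpha q (\<rho> k) (\<sigma> k) * inverse (1 - \<rho> k) * \<rho> k ^ n)
      / (\<Sum>k=1..K. c k * \<rho> k ^ n)"

(* The rate of the step (0,-1) in (0,n), for n at least 1. *)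
definition bar_v_down ::
  "nat \<Rightarrow> (nat \<Rightarrow> real) \<Rightarrow> (nat \<Rightarrow> real) \<Rightarrow> (nat \<Rightarrow> real) \<Rightarrow> (int \<Rightarrow> int \<Rightarrow> real) \<Rightarrow> real \<Rightarrow>
   nat \<Rightarrow> real" where
  "bar_v_down K c \<rho> \<sigma> q v01 n =
    (\<Sum>k=1..K. c k * \<sigma> k ^ (n - 1)) / (\<Sum>k=1..K. c k * \<sigma> k ^ n) * v01
    - (\<Sum>k=1..K. c k * beta q (\<rho> k) (\<sigma> k) * inverse (1 - \<sigma> k) * \<sigma> k ^ n)
      / (\<Sum>k=1..K. c k * \<sigma> k ^ n)"

(* The two fractions above are meaningful in every n \<ge> 1. *)
definition construction_well_defined ::
  "nat \<Rightarrow> (nat \<Rightarrow> real) \<Rightarrow> (nat \<Rightarrow> real) \<Rightarrow> (nat \<Rightarrow> real) \<Rightarrow> bool" where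
  "construction_well_defined K c \<rho> \<sigma> \<longleftrightarrow>
    (\<forall>n\<ge>1. (\<Sum>k=1..K. c k * \<rho> k ^ n) \<noteq> 0 \<and> (\<Sum>k=1..K. c k * \<sigma> k ^ n) \<noteq> 0)"

definition bar_h ::
  "nat \<Rightarrow> (nat \<Rightarrow> real) \<Rightarrow> (nat \<Rightarrow> real) \<Rightarrow> (nat \<Rightarrow> real) \<Rightarrow> (int \<Rightarrow> int \<Rightarrow> real) \<Rightarrow> real \<Rightarrow>
   nat \<Rightarrow> int \<Rightarrow> int \<Rightarrow> real" where
  "bar_h K c \<rho> \<sigma> q h10 n i j =
    (if j = 1 then q i 1 else if i = 1 then h10 else bar_h_left K c \<rho> \<sigma> q h10 n)"

definition bar_v ::
  "nat \<Rightarrow> (nat \<Rightarrow> real) \<Rightarrow> (nat \<Rightarrow> real) \<Rightarrow> (nat \<Rightarrow> real) \<Rightarrow> (int \<Rightarrow> int \<Rightarrow> real) \<Rightarrow> real \<Rightarrow>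
   nat \<Rightarrow> int \<Rightarrow> int \<Rightarrow> real" where
  "bar_v K c \<rho> \<sigma> q v01 n i j =
    (if i = 1 then q 1 j else if j = 1 then v01 else bar_v_down K c \<rho> \<sigma> q v01 n)"

definition bar_r :: "(int \<Rightarrow> int \<Rightarrow> real) \<Rightarrow> real \<Rightarrow> real \<Rightarrow> int \<Rightarrow> int \<Rightarrow> real" where
  "bar_r q h10 v01 i j =
    (if (i, j) = (1, 0) then h10 else if (i, j) = (0, 1) then v01 else q 1 1)"

definition bar_walk ::
  "nat \<Rightarrow> (nat \<Rightarrow> real) \<Rightarrow> (nat \<Rightarrow> real) \<Rightarrow> (nat \<Rightarrow> real) \<Rightarrow> (int \<Rightarrow> int \<Rightarrow> real) \<Rightarrow> real \<Rightarrow> real \<Rightarrow>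
   walk" where
  "bar_walk K c \<rho> \<sigma> q h10 v01 =
    quadrant_walk (bar_h K c \<rho> \<sigma> q h10) (bar_v K c \<rho> \<sigma> q v01) (bar_r q h10 v01) q"


subsection \<open>Uniformization, rewards and bias terms\<close>

definition uniformization_constant :: "real \<Rightarrow> walk \<Rightarrow> bool" where
  "uniformization_constant \<gamma> w \<longleftrightarrow> 0 < \<gamma> \<and> (\<forall>x. exit_rate w x \<le> \<gamma>)"

definition uniformized_prob :: "real \<Rightarrow> walk \<Rightarrow> state \<Rightarrow> step \<Rightarrow> real" where
  "uniformized_prob \<gamma> w x d = (if d = (0, 0) then 1 - exit_rate w x / \<gamma> else w x d / \<gamma>)"

primrec cumulative_reward :: "real \<Rightarrow> walk \<Rightarrow> (state \<Rightarrow> real) \<Rightarrow> nat \<Rightarrow> state \<Rightarrow> real" where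
  "cumulative_reward \<gamma> w F 0 x = 0"
| "cumulative_reward \<gamma> w F (Suc t) x =
    F x + (\<Sum>d\<in>nbr x \<union> {(0, 0)}. uniformized_prob \<gamma> w x d * cumulative_reward \<gamma> w F t (move x d))"

definition bias :: "real \<Rightarrow> walk \<Rightarrow> (state \<Rightarrow> real) \<Rightarrow> nat \<Rightarrow> step \<Rightarrow> state \<Rightarrow> real" where
  "bias \<gamma> w F t d x = cumulative_reward \<gamma> w F t (move x d) - cumulative_reward \<gamma> w F t x"

definition expected_reward :: "(state \<Rightarrow> real) \<Rightarrow> (state \<Rightarrow> real) \<Rightarrow> real" where
  "expected_reward p F = (\<Sum>\<^sub>\<infinity>x\<in>UNIV. p x * F x)"


subsection \<open>Notation of the error bound\<close>

(* In the construction the rate of (i,1) on the horizontal axis is q i 1, and that of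
   (1,j) on the vertical axis is q 1 j. *)
definition delta_h :: "(int \<Rightarrow> int \<Rightarrow> real) \<Rightarrow> (int \<Rightarrow> int \<Rightarrow> real) \<Rightarrow> real" where
  "delta_h q h = (\<Sum>i\<in>{-1..1}. \<bar>q i 1 - h i 1\<bar>)"

definition delta_v :: "(int \<Rightarrow> int \<Rightarrow> real) \<Rightarrow> (int \<Rightarrow> int \<Rightarrow> real) \<Rightarrow> real" where
  "delta_v q v = (\<Sum>j\<in>{-1..1}. \<bar>q 1 j - v 1 j\<bar>)"

definition delta_r ::
  "(int \<Rightarrow> int \<Rightarrow> real) \<Rightarrow> (int \<Rightarrow> int \<Rightarrow> real) \<Rightarrow> real \<Rightarrow> real \<Rightarrow> real" where
  "delta_r q r h10 v01 = (\<Sum>(i, j)\<in>N3. \<bar>bar_r q h10 v01 i j - r i j\<bar>)"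

(* Polylogarithm of integer order; the series over k \<ge> 1 is shifted to start at 0. *)
definition polylog :: "int \<Rightarrow> real \<Rightarrow> real" where
  "polylog s z = (\<Sum>k. z ^ Suc k / real (Suc k) powi s)"

end

theory Submission
  imports Defs
begin

text \<open>
  Write \<open>P\<close> and \<open>P'\<close> for the transition operators of the two uniformized chains, \<open>R t\<close> for the
  cumulative reward of the homogeneous chain up to time \<open>t\<close>, \<open>p\<close> for the sum of geometric terms and
  \<open>0\<close> for the origin.

  Since \<open>p\<close> is stationary for \<open>P'\<close> (lemma \<open>stationary_geometric_sum\<close>), averaging the recursion
  \<open>R (Suc t) = F + P (R t)\<close> against \<open>p\<close> shows, as long as everything is summable, that the mean of
  \<open>R t\<close> grows in one step by the mean of \<open>F\<close> minus the mean of \<open>P' (R t) - P (R t)\<close>. That difference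
  lives on the axes and is a combination of bias terms, so its mean is at most \<open>g\<close>, the claimed bound
  divided by the uniformization constant. Hence \<open>t\<close> times the mean of \<open>F\<close> is the mean of \<open>R t\<close> up to
  \<open>t * g\<close>. It remains to compare the mean of \<open>R t\<close> with the number \<open>R t 0\<close>, whose growth rate is the
  stationary mean of \<open>F\<close> under the homogeneous walk. The latter is the same comparison applied to the
  stationary distribution of that walk itself, where \<open>g = 0\<close>.

  The comparison (theorem \<open>mean_growth\<close>) rests on recurrence of the origin. From a state \<open>x\<close> the chain
  reaches \<open>0\<close> eventually, and every time unit of delay costs at most a constant, because \<open>R t 0\<close> grows
  by at most a constant per time unit; the mean of the truncated hitting time is \<open>o(t)\<close>. This gives
  the bound of \<open>R t 0\<close> from above. The other direction is delicate because nothing is known about \<open>F\<close>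
  in the interior, where it might fail to be summable. There \<open>F\<close> is capped outside a set \<open>A\<close> that
  contains the places where the two walks differ: outside \<open>A\<close> both walks make the same step, so the
  stationarity argument survives the capping, and on \<open>A\<close> the cumulative reward is left unchanged, so
  that the bias terms still control it. Letting the cap grow yields summability of \<open>F\<close> and the
  inequality together.

  Recurrence is obtained from irreducibility and the existence of a stationary distribution
  (theorem \<open>avoidance_prob_tendsto_0\<close>).
\<close>

section \<open>Summation against a distribution\<close>

abbreviation finite_mean :: "(state \<Rightarrow> real) \<Rightarrow> (state \<Rightarrow> real) \<Rightarrow> bool" where
  "finite_mean p f \<equiv> (\<lambda>x. p x * f x) summable_on UNIV"

lemma mean_add:
  assumes "finite_mean p f" "finite_mean p g"
  shows "finite_mean p (\<lambda>x. f x + g x)"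
    and "expected_reward p (\<lambda>x. f x + g x) = expected_reward p f + expected_reward p g"
  using summable_on_add[OF assms] infsum_add[OF assms]
  by (simp_all add: expected_reward_def distrib_left)

lemma mean_cmult:
  assumes "finite_mean p f"
  shows "finite_mean p (\<lambda>x. a * f x)"
    and "expected_reward p (\<lambda>x. a * f x) = a * expected_reward p f"
  using summable_on_cmult_right[OF assms, of a] infsum_cmult_right[OF assms, of a]
  by (simp_all add: expected_reward_def mult.left_commute)

lemma mean_diff:
  assumes "finite_mean p f" "finite_mean p g"
  shows "finite_mean p (\<lambda>x. f x - g x)"
    and "expected_reward p (\<lambda>x. f x - g x) = expected_reward p f - expected_reward p g"
  using mean_add[OF assms(1) mean_cmult(1)[OF assms(2), of "-1"]] mean_cmult(2)[OF assms(2), of "-1"]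
  by simp_all

lemma mean_sum:
  assumes "\<And>s. s < (t::nat) \<Longrightarrow> finite_mean p (f s)"
  shows "finite_mean p (\<lambda>x. \<Sum>s<t. f s x)
    \<and> expected_reward p (\<lambda>x. \<Sum>s<t. f s x) = (\<Sum>s<t. expected_reward p (f s))"
  using assms
proof (induction t)
  case 0
  show ?case by (simp add: expected_reward_def)
next
  case (Suc t)
  then have "finite_mean p (\<lambda>x. \<Sum>s<t. f s x)
    \<and> expected_reward p (\<lambda>x. \<Sum>s<t. f s x) = (\<Sum>s<t. expected_reward p (f s))" by simp
  with mean_add[of p "\<lambda>x. \<Sum>s<t. f s x" "f t"] Suc.prems[of t] show ?case by simp
qed

text \<open>
  The Cesaro means of a null sequence vanish in the limit. Statements about growth in \<open>t\<close> take the
  form of linear bounds with an arbitrarily small additional slope and an unspecified constant;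
  \<open>le_of_linear_bound\<close> extracts the slopes.
\<close>

lemma linear_bound_of_null_sequence:
  fixes a :: "nat \<Rightarrow> real"
  assumes "a \<longlonglongrightarrow> 0" "0 < \<epsilon>"
  shows "\<exists>D. \<forall>t. (\<Sum>s<t. a s) \<le> D + \<epsilon> * real t"
proof -
  from assms obtain n where n: "\<And>s. s \<ge> n \<Longrightarrow> \<bar>a s\<bar> < \<epsilon>"
    using LIMSEQ_D[of a 0 \<epsilon>] by auto
  define D where "D = (\<Sum>s<n. \<bar>a s\<bar>)"
  have "(\<Sum>s<t. a s) \<le> D + \<epsilon> * real t" for t
  proof -
    have "a s \<le> (if s < n then \<bar>a s\<bar> else 0) + \<epsilon>" for s
      using n[of s] assms(2) by (cases "s < n") auto
    then have "(\<Sum>s<t. a s) \<le> (\<Sum>s<t. (if s < n then \<bar>a s\<bar> else 0) + \<epsilon>)"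
      by (intro sum_mono)
    also have "\<dots> = (\<Sum>s<t. if s < n then \<bar>a s\<bar> else 0) + \<epsilon> * real t"
      by (simp add: sum.distrib)
    also have "(\<Sum>s<t. if s < n then \<bar>a s\<bar> else 0) = (\<Sum>s\<in>{..<t} \<inter> {..<n}. \<bar>a s\<bar>)"
      by (simp add: sum.inter_restrict)
    also have "\<dots> \<le> D" unfolding D_def by (intro sum_mono2) auto
    finally show ?thesis by simp
  qed
  then show ?thesis by blast
qed

locale distribution =
  fixes p :: "state \<Rightarrow> real"
  assumes prob: "prob_distribution p"
begin

lemma p_nonneg: "0 \<le> p x"
  using prob unfolding prob_distribution_def by blast

lemma mean_const: "finite_mean p (\<lambda>_. a)" "expected_reward p (\<lambda>_. a) = a"
proof -
  have h: "((\<lambda>x. p x * a) has_sum 1 * a) UNIV"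
    using prob has_sum_cmult_left prob_distribution_def by blast
  show "finite_mean p (\<lambda>_. a)" using h by (rule has_sum_imp_summable)
  show "expected_reward p (\<lambda>_. a) = a"
    using infsumI[OF h] by (simp add: expected_reward_def)
qed

lemma mean_mono:
  assumes "finite_mean p f" "finite_mean p g" "\<And>x. f x \<le> g x"
  shows "expected_reward p f \<le> expected_reward p g"
  unfolding expected_reward_def
  by (rule infsum_mono) (use assms in \<open>auto intro: mult_left_mono p_nonneg\<close>)

lemma finite_mean_dominated:
  assumes "finite_mean p g" "\<And>x. \<bar>f x\<bar> \<le> g x"
  shows "finite_mean p f"
proof -
  have "(\<lambda>x. \<bar>p x * f x\<bar>) summable_on UNIV"
    by (rule summable_on_comparison_test[OF assms(1)])
       (use assms(2) in \<open>auto simp: abs_mult p_nonneg intro: mult_left_mono\<close>)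
  then show ?thesis
    by (subst summable_on_iff_abs_summable_on_real) simp
qed

lemma mean_nonneg: "(\<And>x. 0 \<le> f x) \<Longrightarrow> 0 \<le> expected_reward p f"
  unfolding expected_reward_def by (intro infsum_nonneg mult_nonneg_nonneg p_nonneg)

lemma mean_approx_finite:
  assumes "finite_mean p f" "0 < \<epsilon>"
  obtains E where "finite E" "expected_reward p f - (\<Sum>x\<in>E. p x * f x) \<le> \<epsilon>"
  using has_sum_finite_approximation[OF has_sum_infsum[OF assms(1)] assms(2)]
  by (auto simp: dist_real_def expected_reward_def abs_if split: if_splits)

lemma mean_split_finite:
  assumes f: "finite_mean p f" and E: "finite E"
  shows "finite_mean p (\<lambda>x. if x \<in> E then 0 else f x)"
    and "expected_reward p (\<lambda>x. if x \<in> E then 0 else f x) = expected_reward p f - (\<Sum>x\<in>E. p x * f x)"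
proof -
  have h: "((\<lambda>x. p x * (if x \<in> E then f x else 0)) has_sum (\<Sum>x\<in>E. p x * f x)) UNIV"
    by (rule has_sum_cong_neutral[THEN iffD1, OF _ _ _ has_sum_finite[OF E, of "\<lambda>x. p x * f x"]]) auto
  have eq: "(\<lambda>x. f x - (if x \<in> E then f x else 0)) = (\<lambda>x. if x \<in> E then 0 else f x)"
    by auto
  have s: "finite_mean p (\<lambda>x. if x \<in> E then f x else 0)"
    using h by (rule has_sum_imp_summable)
  show "finite_mean p (\<lambda>x. if x \<in> E then 0 else f x)"
    by (rule summable_on_cong[THEN iffD1, OF _ mean_diff(1)[OF f s]]) auto
  show "expected_reward p (\<lambda>x. if x \<in> E then 0 else f x) = expected_reward p f - (\<Sum>x\<in>E. p x * f x)"
    using mean_diff(2)[OF f s] infsumI[OF h]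
      by (simp add: eq expected_reward_def[of p "\<lambda>x. if x \<in> E then f x else 0"])
qed

text \<open>
  Dominated convergence, with a constant as the dominating function: all but \<open>\<epsilon>\<close> of the mass
  of \<open>p\<close> sits on a finite set, and on that set the convergence is uniform.
\<close>

lemma mean_bounded_convergence:
  fixes f :: "nat \<Rightarrow> state \<Rightarrow> real"
  assumes bounds: "\<And>n x. 0 \<le> f n x" "\<And>n x. f n x \<le> 1" and lim: "\<And>x. (\<lambda>n. f n x) \<longlonglongrightarrow> 0"
  shows "(\<lambda>n. expected_reward p (f n)) \<longlonglongrightarrow> 0"
proof (rule LIMSEQ_I)
  fix \<epsilon> :: real assume \<epsilon>: "0 < \<epsilon>"
  obtain E where E: "finite E" "expected_reward p (\<lambda>_. 1) - (\<Sum>x\<in>E. p x * 1) \<le> \<epsilon>/2"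
    using mean_approx_finite[OF mean_const(1)[of 1], of "\<epsilon>/2"] \<epsilon> by auto
  have fm: "finite_mean p (f n)" for n
    by (rule finite_mean_dominated[OF mean_const(1)[of 1]]) (use bounds in auto)
  have "(\<lambda>n. \<Sum>x\<in>E. p x * f n x) \<longlonglongrightarrow> (\<Sum>x\<in>E. p x * 0)"
    by (intro tendsto_intros lim)
  from LIMSEQ_D[OF this, of "\<epsilon>/2"] \<epsilon> obtain N
    where N: "\<And>n. n \<ge> N \<Longrightarrow> \<bar>\<Sum>x\<in>E. p x * f n x\<bar> < \<epsilon>/2" by auto
  have "norm (expected_reward p (f n) - 0) < \<epsilon>" if "n \<ge> N" for n
  proof -
    have "expected_reward p (\<lambda>x. if x \<in> E then 0 else f n x)
        \<le> expected_reward p (\<lambda>x. if x \<in> E then 0 else 1)"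
      by (intro mean_mono mean_split_finite fm mean_const E) (use bounds in auto)
    then have "expected_reward p (f n) - (\<Sum>x\<in>E. p x * f n x) \<le> \<epsilon>/2"
      using E mean_split_finite(2)[OF fm[of n] E(1)] mean_split_finite(2)[OF mean_const(1)[of 1] E(1)]
      by linarith
    moreover have "0 \<le> expected_reward p (f n)" by (intro mean_nonneg bounds)
    ultimately show ?thesis using N[OF that] by simp
  qed
  then show "\<exists>N. \<forall>n\<ge>N. norm (expected_reward p (f n) - 0) < \<epsilon>" by blast
qed

end

section \<open>The uniformized chain\<close>

definition one_step :: "real \<Rightarrow> walk \<Rightarrow> (state \<Rightarrow> real) \<Rightarrow> state \<Rightarrow> real" where
  "one_step \<gamma> w f x = (\<Sum>d\<in>nbr x \<union> {(0, 0)}. uniformized_prob \<gamma> w x d * f (move x d))"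

lemma cumulative_reward_Suc:
  "cumulative_reward \<gamma> w F (Suc t) x = F x + one_step \<gamma> w (cumulative_reward \<gamma> w F t) x"
  by (simp add: one_step_def)

lemma finite_N: "finite N1" "finite N2" "finite N3" "finite N4"
  by (simp_all add: N1_def N2_def N3_def N4_def)

lemma finite_nbr: "finite (nbr x)"
  by (rule finite_subset[OF _ finite_N(4)]) (auto simp: nbr_def)

lemma null_step_notin_nbr: "(0, 0) \<notin> nbr x"
  by (simp add: nbr_def N4_def)

lemma move_null [simp]: "move x (0, 0) = x"
  by (simp add: move_def)

lemma nbr_inverse_step:
  assumes "d \<in> nbr x"
  shows "- d \<in> nbr (move x d)" "move (move x d) (- d) = x"
proof -
  obtain m n i j where x: "x = (m, n)" and d: "d = (i, j)" by (cases x, cases d)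
  have h: "(i, j) \<in> N4" "0 \<le> int m + i" "0 \<le> int n + j"
    using assms by (simp_all add: x d nbr_def)
  have "(- i, - j) \<in> N4" using h(1) by (auto simp: N4_def)
  then show "- d \<in> nbr (move x d)"
    using h(2,3) by (simp add: x d nbr_def move_def)
  show "move (move x d) (- d) = x"
    using h(2,3) by (simp add: x d move_def)
qed

text \<open>
  Reversing a step pairs the transitions into a state with the transitions out of it.
\<close>

lemma incoming_eq: "incoming y = (\<lambda>e. (move y e, - e)) ` nbr y"
proof (intro set_eqI iffI)
  fix z assume "z \<in> incoming y"
  then obtain x d where z: "z = (x, d)" and d: "d \<in> nbr x" "move x d = y"
    unfolding incoming_def by blast
  from nbr_inverse_step[OF d(1)] show "z \<in> (\<lambda>e. (move y e, - e)) ` nbr y"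
    unfolding z d(2) by (intro image_eqI[where x = "- d"]) simp_all
next
  fix z assume "z \<in> (\<lambda>e. (move y e, - e)) ` nbr y"
  then obtain e where "e \<in> nbr y" "z = (move y e, - e)" by blast
  then show "z \<in> incoming y"
    unfolding incoming_def using nbr_inverse_step[of e y] by blast
qed

lemma sum_incoming: "(\<Sum>(x, d)\<in>incoming y. f x d) = (\<Sum>e\<in>nbr y. f (move y e) (- e))"
  unfolding incoming_eq by (subst sum.reindex) (auto simp: inj_on_def)

text \<open>
  The generator form. It eliminates the holding probability and brings out the differences of \<open>f\<close>,
  which for cumulative rewards are the bias terms.
\<close>

lemma one_step_eq:
  "one_step \<gamma> w f x = f x + (\<Sum>d\<in>nbr x. w x d * (f (move x d) - f x)) / \<gamma>"
proof -
  have "one_step \<gamma> w f x = uniformized_prob \<gamma> w x (0,0) * f x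
      + (\<Sum>d\<in>nbr x. uniformized_prob \<gamma> w x d * f (move x d))"
    unfolding one_step_def by (subst sum.union_disjoint)
      (auto simp: finite_nbr null_step_notin_nbr)
  also have "(\<Sum>d\<in>nbr x. uniformized_prob \<gamma> w x d * f (move x d)) = (\<Sum>d\<in>nbr x. w x d / \<gamma> * f (move x d))"
    by (rule sum.cong) (auto simp: uniformized_prob_def null_step_notin_nbr)
  finally show ?thesis
    by (simp add: uniformized_prob_def exit_rate_def algebra_simps sum_subtractf
        sum_distrib_left sum_distrib_right sum_divide_distrib diff_divide_distrib)
qed

lemma one_step_cong: "(\<And>d. d \<in> nbr x \<Longrightarrow> w x d = w' x d) \<Longrightarrow> one_step \<gamma> w f x = one_step \<gamma> w' f x"
  unfolding one_step_eq by (simp cong: sum.cong)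

lemma one_step_add: "one_step \<gamma> w (\<lambda>x. f x + g x) x = one_step \<gamma> w f x + one_step \<gamma> w g x"
  by (simp add: one_step_def distrib_left sum.distrib)

lemma one_step_cmult: "one_step \<gamma> w (\<lambda>x. a * f x) x = a * one_step \<gamma> w f x"
  by (simp add: one_step_def sum_distrib_left mult.left_commute)

lemma one_step_const: "one_step \<gamma> w (\<lambda>_. a) x = a"
  by (simp add: one_step_eq)

lemma one_step_sum: "one_step \<gamma> w (\<lambda>x. \<Sum>s<(t::nat). f s x) x = (\<Sum>s<t. one_step \<gamma> w (f s) x)"
  by (induction t) (simp_all add: one_step_add one_step_const)

lemma one_step_tendsto:
  "(\<And>y. (\<lambda>n. f n y) \<longlonglongrightarrow> g y) \<Longrightarrow> (\<lambda>n. one_step \<gamma> w (f n) x) \<longlonglongrightarrow> one_step \<gamma> w g x"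
  unfolding one_step_def by (intro tendsto_intros)

text \<open>
  The transition operator followed by killing on \<open>A\<close>. Its iterates applied to a function that
  vanishes on \<open>A\<close> average that function over the paths that have stayed outside \<open>A\<close>.
\<close>

definition killed_step :: "real \<Rightarrow> walk \<Rightarrow> state set \<Rightarrow> (state \<Rightarrow> real) \<Rightarrow> state \<Rightarrow> real" where
  "killed_step \<gamma> w A f x = (if x \<in> A then 0 else one_step \<gamma> w f x)"

definition avoidance_prob :: "real \<Rightarrow> walk \<Rightarrow> state set \<Rightarrow> nat \<Rightarrow> state \<Rightarrow> real" where
  "avoidance_prob \<gamma> w A n = (killed_step \<gamma> w A ^^ n) (\<lambda>x. if x \<in> A then 0 else 1)"

lemma avoidance_prob_0: "avoidance_prob \<gamma> w A 0 x = (if x \<in> A then 0 else 1)"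
  by (simp add: avoidance_prob_def)

lemma avoidance_prob_Suc:
  "avoidance_prob \<gamma> w A (Suc n) = killed_step \<gamma> w A (avoidance_prob \<gamma> w A n)"
  by (simp add: avoidance_prob_def)

lemma avoidance_prob_on: "x \<in> A \<Longrightarrow> avoidance_prob \<gamma> w A n x = 0"
  by (cases n) (simp_all add: avoidance_prob_0 avoidance_prob_Suc killed_step_def)

locale uniformized_walk =
  fixes \<gamma> :: real and w :: walk
  assumes nonneg: "nonneg_rates w" and uniformizable: "uniformization_constant \<gamma> w"
begin

lemma \<gamma>_pos: "0 < \<gamma>"
  using uniformizable by (simp add: uniformization_constant_def)

lemma exit_rate_le: "exit_rate w x \<le> \<gamma>"
  using uniformizable unfolding uniformization_constant_def by blast

lemma rate_nonneg: "d \<in> nbr x \<Longrightarrow> 0 \<le> w x d"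
  using nonneg unfolding nonneg_rates_def by blast

lemma uniformized_prob_nonneg: "d \<in> nbr x \<union> {(0, 0)} \<Longrightarrow> 0 \<le> uniformized_prob \<gamma> w x d"
  using \<gamma>_pos exit_rate_le[of x] rate_nonneg[of d x] null_step_notin_nbr[of x]
  by (auto simp: uniformized_prob_def divide_le_eq)

lemma one_step_mono: "(\<And>y. f y \<le> g y) \<Longrightarrow> one_step \<gamma> w f x \<le> one_step \<gamma> w g x"
  unfolding one_step_def by (intro sum_mono mult_left_mono uniformized_prob_nonneg) auto

lemma one_step_nonneg: "(\<And>y. 0 \<le> f y) \<Longrightarrow> 0 \<le> one_step \<gamma> w f x"
  using one_step_mono[of "\<lambda>_. 0" f x] by (simp add: one_step_const)

lemma killed_step_mono: "(\<And>y. f y \<le> g y) \<Longrightarrow> killed_step \<gamma> w A f x \<le> killed_step \<gamma> w A g x"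
  by (simp add: killed_step_def one_step_mono)

lemma killed_step_nonneg: "(\<And>y. 0 \<le> f y) \<Longrightarrow> 0 \<le> killed_step \<gamma> w A f x"
  by (simp add: killed_step_def one_step_nonneg)

lemma killed_power_nonneg: "(\<And>y. 0 \<le> f y) \<Longrightarrow> 0 \<le> (killed_step \<gamma> w A ^^ n) f x"
  by (induction n arbitrary: x) (simp_all add: killed_step_nonneg)

lemma killed_power_mono: "(\<And>y. f y \<le> g y) \<Longrightarrow> (killed_step \<gamma> w A ^^ n) f x \<le> (killed_step \<gamma> w A ^^ n) g x"
  by (induction n arbitrary: x) (simp_all add: killed_step_mono)

lemma killed_step_add_cmult:
  "killed_step \<gamma> w A (\<lambda>x. f x + a * g x) x = killed_step \<gamma> w A f x + a * killed_step \<gamma> w A g x"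
  by (simp add: killed_step_def one_step_add one_step_cmult)

lemma killed_power_add_cmult:
  "(killed_step \<gamma> w A ^^ n) (\<lambda>x. f x + a * g x) x
    = (killed_step \<gamma> w A ^^ n) f x + a * (killed_step \<gamma> w A ^^ n) g x"
proof (induction n arbitrary: x)
  case (Suc n)
  have "(killed_step \<gamma> w A ^^ n) (\<lambda>x. f x + a * g x)
      = (\<lambda>x. (killed_step \<gamma> w A ^^ n) f x + a * (killed_step \<gamma> w A ^^ n) g x)"
    using Suc by blast
  then show ?case by (simp add: killed_step_add_cmult)
qed simp

lemma avoidance_prob_nonneg: "0 \<le> avoidance_prob \<gamma> w A n x"
  unfolding avoidance_prob_def by (intro killed_power_nonneg) auto

lemma avoidance_prob_antimono: "avoidance_prob \<gamma> w A (Suc n) x \<le> avoidance_prob \<gamma> w A n x"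
proof (induction n arbitrary: x)
  case 0
  have "one_step \<gamma> w (avoidance_prob \<gamma> w A 0) x \<le> one_step \<gamma> w (\<lambda>_. 1) x"
    by (intro one_step_mono) (simp add: avoidance_prob_0)
  then show ?case
    by (simp add: avoidance_prob_Suc avoidance_prob_0 killed_step_def one_step_const)
next
  case (Suc n)
  then show ?case by (subst (1 2) avoidance_prob_Suc) (rule killed_step_mono)
qed

lemma avoidance_prob_le_1: "avoidance_prob \<gamma> w A n x \<le> 1"
proof (induction n)
  case (Suc n)
  then show ?case using avoidance_prob_antimono[of A n x] by linarith
qed (simp add: avoidance_prob_0)

lemma avoidance_prob_subset: "A \<subseteq> B \<Longrightarrow> avoidance_prob \<gamma> w B n x \<le> avoidance_prob \<gamma> w A n x"
proof (induction n arbitrary: x)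
  case (Suc n)
  then show ?case
    using avoidance_prob_nonneg[of A n]
    by (auto simp: avoidance_prob_Suc killed_step_def intro: one_step_mono one_step_nonneg)
qed (auto simp: avoidance_prob_0)

end

section \<open>Stationary distributions and recurrence\<close>

locale stationary_walk = uniformized_walk +
  fixes p :: "state \<Rightarrow> real"
  assumes stationary: "stationary_distribution w p"
begin

sublocale distribution p
  using stationary by unfold_locales (simp add: stationary_distribution_def)

lemma balance: "p y * exit_rate w y = (\<Sum>e\<in>nbr y. p (move y e) * w (move y e) (- e))"
proof -
  have "p y * exit_rate w y = (\<Sum>(x, d)\<in>incoming y. p x * w x d)"
    using stationary unfolding stationary_distribution_def by blast
  then show ?thesis by (simp only: sum_incoming)
qed

text \<open>
  Balance compares, in each state, the outflow with the inflow. Multiplying by \<open>f\<close> and summing,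
  the inflows become a sum over all transitions ordered by their targets, and reversing the steps
  orders it by the sources.
\<close>

lemma stationary_mean:
  assumes f0: "\<And>x. 0 \<le> f x" and f: "finite_mean p f"
  shows "finite_mean p (one_step \<gamma> w f)"
    and "expected_reward p (one_step \<gamma> w f) = expected_reward p f"
proof -
  define Z where "Z = Sigma UNIV nbr"
  define out where "out y = p y * exit_rate w y * f y" for y
  define T where "T = infsum out UNIV"
  define inflow where "inflow = (\<lambda>(y, e). p (move y e) * w (move y e) (- e) * f y)"
  define outflow where "outflow = (\<lambda>(x, d). p x * w x d * f (move x d))"
  have exit_nonneg: "0 \<le> exit_rate w y" for y
    unfolding exit_rate_def by (intro sum_nonneg rate_nonneg)
  have out_summable: "out summable_on UNIV"
  proof (rule summable_on_comparison_test)
    show "(\<lambda>y. \<gamma> * (p y * f y)) summable_on UNIV"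
      using f by (rule summable_on_cmult_right)
    show "out y \<le> \<gamma> * (p y * f y)" for y
      using mult_right_mono[OF exit_rate_le[of y], of "p y * f y"] p_nonneg[of y] f0[of y]
      by (simp add: out_def mult.assoc mult.left_commute)
    show "0 \<le> out y" for y
      using p_nonneg f0 exit_nonneg by (simp add: out_def)
  qed
  have inflow_sum: "((\<lambda>e. inflow (y, e)) has_sum out y) (nbr y)" for y
    using has_sum_finite[OF finite_nbr[of y], of "\<lambda>e. inflow (y, e)"]
    by (simp add: inflow_def out_def balance sum_distrib_right)
  have "inflow summable_on Z" unfolding Z_def
  proof (rule summable_on_SigmaI[OF inflow_sum out_summable])
    show "0 \<le> inflow (y, e)" if "e \<in> nbr y" for y e
      using rate_nonneg[OF nbr_inverse_step(1)[OF that]] p_nonneg f0 by (simp add: inflow_def)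
  qed
  then have "(inflow has_sum T) Z"
    unfolding Z_def T_def
    by (intro has_sum_SigmaI[OF inflow_sum has_sum_infsum[OF out_summable]])
  moreover have "(outflow has_sum T) Z \<longleftrightarrow> (inflow has_sum T) Z"
    by (rule has_sum_reindex_bij_witness[where
          i = "\<lambda>(y, e). (move y e, - e)" and j = "\<lambda>(y, e). (move y e, - e)"])
      (auto simp: Z_def nbr_inverse_step[of "(i, j)" for i j, simplified] inflow_def outflow_def)
  ultimately have "(outflow has_sum T) Z" by simp
  then have "((\<lambda>x. \<Sum>d\<in>nbr x. outflow (x, d)) has_sum T) UNIV"
    unfolding Z_def by (rule has_sum_SigmaD) (rule has_sum_finite[OF finite_nbr])
  moreover have "(out has_sum T) UNIV"
    unfolding T_def using out_summable by (rule has_sum_infsum)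
  ultimately have "((\<lambda>x. inverse \<gamma> * ((\<Sum>d\<in>nbr x. outflow (x, d)) + - out x)) has_sum
      inverse \<gamma> * (T + - T)) UNIV"
    by (intro has_sum_cmult_right has_sum_add has_sum_uminus[THEN iffD2]) simp_all
  moreover have "((\<lambda>x. p x * f x) has_sum expected_reward p f) UNIV"
    unfolding expected_reward_def using f by (rule has_sum_infsum)
  ultimately have "((\<lambda>x. p x * f x + inverse \<gamma> * ((\<Sum>d\<in>nbr x. outflow (x, d)) + - out x)) has_sum
      expected_reward p f + inverse \<gamma> * (T + - T)) UNIV"
    by (rule has_sum_add[rotated])
  moreover have "p x * f x + inverse \<gamma> * ((\<Sum>d\<in>nbr x. outflow (x, d)) + - out x)
      = p x * one_step \<gamma> w f x" for x
    by (simp add: one_step_eq outflow_def out_def exit_rate_def algebra_simps sum_subtractf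
        sum_distrib_left sum_distrib_right divide_inverse)
  ultimately have h: "((\<lambda>x. p x * one_step \<gamma> w f x) has_sum expected_reward p f) UNIV"
    by simp
  show "finite_mean p (one_step \<gamma> w f)" using h by (rule has_sum_imp_summable)
  show "expected_reward p (one_step \<gamma> w f) = expected_reward p f"
    using infsumI[OF h] by (simp add: expected_reward_def)
qed

lemma killed_step_mean:
  assumes "\<And>x. 0 \<le> f x" "finite_mean p f"
  shows "finite_mean p (killed_step \<gamma> w A f)"
    and "expected_reward p (killed_step \<gamma> w A f) \<le> expected_reward p f"
proof -
  have le: "killed_step \<gamma> w A f x \<le> one_step \<gamma> w f x" and "0 \<le> killed_step \<gamma> w A f x" for x
    using one_step_nonneg[of f x] assms(1) by (auto simp: killed_step_def)
  then show fin: "finite_mean p (killed_step \<gamma> w A f)"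
    by (intro finite_mean_dominated[OF stationary_mean(1)[OF assms]]) auto
  show "expected_reward p (killed_step \<gamma> w A f) \<le> expected_reward p f"
    using mean_mono[OF fin stationary_mean(1)[OF assms] le] stationary_mean(2)[OF assms] by simp
qed

lemma killed_power_mean:
  assumes "\<And>x. 0 \<le> f x" "finite_mean p f"
  shows "finite_mean p ((killed_step \<gamma> w A ^^ n) f)
    \<and> expected_reward p ((killed_step \<gamma> w A ^^ n) f) \<le> expected_reward p f"
proof (induction n)
  case (Suc n)
  then show ?case
    using killed_step_mean[of "(killed_step \<gamma> w A ^^ n) f" A]
      killed_power_nonneg[where f = f and A = A and n = n] assms(1)
    by fastforce
qed (use assms in simp)

lemma avoidance_prob_mean: "finite_mean p (avoidance_prob \<gamma> w A n)"
  by (rule finite_mean_dominated[OF mean_const(1)[of 1]])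
     (simp add: avoidance_prob_nonneg avoidance_prob_le_1)

text \<open>
  The part of \<open>f\<close> outside a large finite set has small mean, which killing does not increase.
  The other part is bounded, hence controlled by the probability of survival.
\<close>

lemma killed_power_mean_tendsto_0:
  assumes f0: "\<And>x. 0 \<le> f x" and f: "finite_mean p f" and fA: "\<And>x. x \<in> A \<Longrightarrow> f x = 0"
    and lim: "\<And>x. (\<lambda>n. avoidance_prob \<gamma> w A n x) \<longlonglongrightarrow> 0"
  shows "(\<lambda>n. expected_reward p ((killed_step \<gamma> w A ^^ n) f)) \<longlonglongrightarrow> 0"
proof (rule LIMSEQ_I)
  fix \<epsilon> :: real assume \<epsilon>: "0 < \<epsilon>"
  obtain E where E: "finite E" "expected_reward p f - (\<Sum>x\<in>E. p x * f x) \<le> \<epsilon>/2"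
    using mean_approx_finite[OF f, of "\<epsilon>/2"] \<epsilon> by auto
  define tail where "tail = (\<lambda>x. if x \<in> E then 0 else f x)"
  define N where "N = (\<Sum>x\<in>E. f x)"
  define ind where "ind = (\<lambda>x. if x \<in> A then 0 else 1 :: real)"
  have tail0: "0 \<le> tail x" for x using f0 by (simp add: tail_def)
  have tail: "finite_mean p tail" "expected_reward p tail \<le> \<epsilon>/2"
    using mean_split_finite[OF f E(1)] E(2) by (simp_all add: tail_def)
  have le: "f x \<le> tail x + N * ind x" for x
    using member_le_sum[of x E f] E(1) f0 fA sum_nonneg[of E f]
    by (auto simp: tail_def ind_def N_def)
  let ?K = "\<lambda>f n. (killed_step \<gamma> w A ^^ n) f"
  have "(\<lambda>n. N * expected_reward p (avoidance_prob \<gamma> w A n)) \<longlonglongrightarrow> N * 0"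
    by (intro tendsto_intros mean_bounded_convergence lim avoidance_prob_nonneg avoidance_prob_le_1)
  from LIMSEQ_D[OF this, of "\<epsilon>/2"] \<epsilon> obtain n0
    where n0: "\<And>n. n \<ge> n0 \<Longrightarrow> \<bar>N * expected_reward p (avoidance_prob \<gamma> w A n)\<bar> < \<epsilon>/2" by auto
  have "norm (expected_reward p (?K f n) - 0) < \<epsilon>" if "n \<ge> n0" for n
  proof -
    have le': "?K f n x \<le> ?K tail n x + N * avoidance_prob \<gamma> w A n x" for x
      using killed_power_mono[OF le, where A = A and n = n and x = x]
      by (simp add: killed_power_add_cmult avoidance_prob_def ind_def)
    have K: "finite_mean p (?K tail n)" "expected_reward p (?K tail n) \<le> \<epsilon>/2"
      using killed_power_mean[OF tail0 tail(1), where A = A and n = n] tail(2) by auto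
    note M = mean_cmult[OF avoidance_prob_mean, of N A n]
    have "expected_reward p (?K f n) \<le> expected_reward p (\<lambda>x. ?K tail n x + N * avoidance_prob \<gamma> w A n x)"
      using killed_power_mean[OF f0 f, where A = A and n = n] mean_add(1)[OF K(1) M(1)] le'
      by (intro mean_mono) auto
    also have "\<dots> = expected_reward p (?K tail n) + N * expected_reward p (avoidance_prob \<gamma> w A n)"
      using mean_add(2)[OF K(1) M(1)] M(2) by simp
    finally have "expected_reward p (?K f n) < \<epsilon>" using K(2) n0[OF that] by linarith
    moreover have "0 \<le> expected_reward p (?K f n)"
      by (intro mean_nonneg killed_power_nonneg f0)
    ultimately show ?thesis by simp
  qed
  then show "\<exists>n0. \<forall>n\<ge>n0. norm (expected_reward p (?K f n) - 0) < \<epsilon>" by blast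
qed

lemma irreducible_induct:
  assumes irr: "irreducible_walk w" and base: "Q x"
    and step: "\<And>y d. Q y \<Longrightarrow> d \<in> nbr y \<Longrightarrow> 0 < w y d \<Longrightarrow> Q (move y d)"
  shows "Q z"
proof -
  have "(x, z) \<in> {(x, move x d) | x d. d \<in> nbr x \<and> 0 < w x d}\<^sup>*"
    using irr unfolding irreducible_walk_def by blast
  then show ?thesis by (induction rule: rtrancl_induct) (use base step in auto)
qed

lemma stationary_pos:
  assumes irr: "irreducible_walk w"
  shows "0 < p z"
proof -
  have "\<exists>x. 0 < p x"
  proof (rule ccontr)
    assume "\<not> ?thesis"
    then have "p x = 0" for x using p_nonneg[of x] by (metis less_eq_real_def)
    then have "expected_reward p (\<lambda>_. 1) = 0" by (simp add: expected_reward_def)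
    then show False using mean_const(2)[of 1] by simp
  qed
  then obtain x where "0 < p x" ..
  with irr show ?thesis
  proof (rule irreducible_induct)
    fix y d assume y: "0 < p y" and d: "d \<in> nbr y" and wd: "0 < w y d"
    note inv = nbr_inverse_step[OF d]
    have "p y * w y d = p (move (move y d) (- d)) * w (move (move y d) (- d)) (- (- d))"
      by (simp add: inv)
    also have "\<dots> \<le> (\<Sum>e\<in>nbr (move y d). p (move (move y d) e) * w (move (move y d) e) (- e))"
      by (rule member_le_sum[OF inv(1)])
         (auto intro!: mult_nonneg_nonneg p_nonneg rate_nonneg nbr_inverse_step finite_nbr)
    also have "\<dots> = p (move y d) * exit_rate w (move y d)" by (simp add: balance)
    finally have "0 < p (move y d) * exit_rate w (move y d)"
      using mult_pos_pos[OF y wd] by linarith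
    then show "0 < p (move y d)"
      using p_nonneg[of "move y d"] by (cases "p (move y d) = 0") auto
  qed
qed

text \<open>
  An irreducible walk with a stationary distribution is recurrent. The probability \<open>u\<close> of never
  visiting \<open>z\<close> is subharmonic, and stationarity leaves no room for strict inequality anywhere, so
  that \<open>u\<close> is harmonic. A nonnegative harmonic function that vanishes in \<open>z\<close> vanishes along
  every path out of \<open>z\<close>.
\<close>

theorem avoidance_prob_tendsto_0:
  assumes irr: "irreducible_walk w" and zA: "z \<in> A"
  shows "(\<lambda>n. avoidance_prob \<gamma> w A n x) \<longlonglongrightarrow> 0"
proof -
  let ?s = "avoidance_prob \<gamma> w {z}"
  define u where "u x = lim (\<lambda>n. ?s n x)" for x
  have lim: "(\<lambda>n. ?s n x) \<longlonglongrightarrow> u x" for x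
  proof -
    have "decseq (\<lambda>n. ?s n x)" by (intro decseq_SucI avoidance_prob_antimono)
    then have "convergent (\<lambda>n. ?s n x)"
      using avoidance_prob_nonneg avoidance_prob_le_1
      by (intro Bseq_monoseq_convergent BseqI'[where K = 1]) (auto simp: monoseq_iff abs_le_iff)
    then show ?thesis by (simp add: u_def convergent_LIMSEQ_iff)
  qed
  have u0: "0 \<le> u x" for x
    by (rule LIMSEQ_le_const[OF lim]) (auto intro: avoidance_prob_nonneg)
  have u1: "u x \<le> 1" for x
    by (rule LIMSEQ_le_const2[OF lim]) (auto intro: avoidance_prob_le_1)
  have uz: "u z = 0"
    using lim[of z] by (simp add: avoidance_prob_on LIMSEQ_const_iff)
  have "u x = one_step \<gamma> w u x" if "x \<noteq> z" for x
  proof (rule LIMSEQ_unique[OF LIMSEQ_Suc[OF lim]])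
    show "(\<lambda>n. ?s (Suc n) x) \<longlonglongrightarrow> one_step \<gamma> w u x"
      using that one_step_tendsto[OF lim] by (simp add: avoidance_prob_Suc killed_step_def)
  qed
  then have sub: "u x \<le> one_step \<gamma> w u x" for x
    using uz one_step_nonneg[of u x] u0 by (cases "x = z") auto
  have fu: "finite_mean p u"
    by (rule finite_mean_dominated[OF mean_const(1)[of 1]]) (use u0 u1 in auto)
  note su = stationary_mean[OF u0 fu]
  have "((\<lambda>x. p x * (one_step \<gamma> w u x - u x)) has_sum 0) UNIV"
    using has_sum_infsum[OF mean_diff(1)[OF su(1) fu]] mean_diff(2)[OF su(1) fu] su(2)
    by (simp add: expected_reward_def)
  then have "p x * (one_step \<gamma> w u x - u x) = 0" for x
    by (rule nonneg_has_sum_le_0D) (use sub p_nonneg in auto)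
  then have harmonic: "one_step \<gamma> w u x = u x" for x
    using stationary_pos[OF irr, of x] by (metis mult_eq_0_iff eq_iff_diff_eq_0 less_irrefl)
  have "u x = 0" for x
    using irr uz
  proof (rule irreducible_induct)
    fix y d assume y: "u y = 0" and d: "d \<in> nbr y" and wd: "0 < w y d"
    have "(\<Sum>d\<in>nbr y. w y d * u (move y d)) = 0"
      using harmonic[of y] y \<gamma>_pos by (simp add: one_step_eq)
    then have "w y d * u (move y d) = 0"
      using d rate_nonneg u0 by (subst (asm) sum_nonneg_eq_0_iff) (auto simp: finite_nbr)
    then show "u (move y d) = 0" using wd by simp
  qed
  then have lim0: "(\<lambda>n. ?s n x) \<longlonglongrightarrow> 0" using lim[of x] by simp
  show ?thesis
    by (rule tendsto_sandwich[OF always_eventually always_eventually tendsto_const lim0])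
       (use zA in \<open>auto intro: avoidance_prob_nonneg avoidance_prob_subset\<close>)
qed

end

section \<open>Comparison of a mean reward with the growth of the cumulative reward\<close>

text \<open>
  The cumulative reward, with the reward outside \<open>A\<close> capped at \<open>L\<close> until the first visit to
  \<open>A\<close>, where the true cumulative reward of the remaining time is collected. Its mean against a
  distribution can be finite before anything is known about the mean of \<open>F\<close>.
\<close>

primrec capped_reward ::
  "real \<Rightarrow> walk \<Rightarrow> (state \<Rightarrow> real) \<Rightarrow> state set \<Rightarrow> real \<Rightarrow> nat \<Rightarrow> state \<Rightarrow> real" where
  "capped_reward \<gamma> w F A L 0 x = 0"
| "capped_reward \<gamma> w F A L (Suc t) x =
    (if x \<in> A then cumulative_reward \<gamma> w F (Suc t) x
     else min (F x) L + one_step \<gamma> w (capped_reward \<gamma> w F A L t) x)"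

lemma le_of_linear_bound:
  fixes a b D :: real
  assumes "\<And>t. real t * a \<le> real t * b + D"
  shows "a \<le> b"
proof (rule ccontr)
  assume "\<not> a \<le> b"
  then obtain t where "D < real t * (a - b)"
    using reals_Archimedean3[of "a - b"] by auto
  with assms[of t] show False by (simp add: algebra_simps)
qed

text \<open>
  The reference state \<open>z\<close> is the one from which the cumulative reward is observed; \<open>C\<close> bounds the
  mean reward collected in any single time unit by the chain started there.
\<close>

locale reward_walk = uniformized_walk +
  fixes F :: "state \<Rightarrow> real" and z :: state and C :: real
  assumes F_nonneg: "\<And>x. 0 \<le> F x"
    and growth: "\<And>t. cumulative_reward \<gamma> w F (Suc t) z \<le> cumulative_reward \<gamma> w F t z + C"
begin

abbreviation "R \<equiv> cumulative_reward \<gamma> w F"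

lemma R_Suc: "R (Suc t) x = F x + one_step \<gamma> w (R t) x"
  by (rule cumulative_reward_Suc)

declare cumulative_reward.simps(2) [simp del]

lemma R_nonneg: "0 \<le> R t x"
  by (induction t arbitrary: x) (simp_all add: R_Suc F_nonneg one_step_nonneg)

lemma R_mono: "R t x \<le> R (Suc t) x"
proof (induction t arbitrary: x)
  case 0
  show ?case using R_nonneg[of "Suc 0" x] by simp
next
  case (Suc t)
  have "one_step \<gamma> w (R t) x \<le> one_step \<gamma> w (R (Suc t)) x"
    by (rule one_step_mono) (rule Suc)
  then show ?case by (subst (1 2) R_Suc) simp
qed

lemma R_le_linear: "R t z \<le> real t * C"
proof (induction t)
  case (Suc t)
  then show ?case using growth[of t] by (simp add: distrib_right)
qed simp

text \<open>
  From \<open>x\<close>, drop the rewards collected before the first visit to \<open>z\<close>. Each time unit spent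
  before that visit costs at most \<open>C\<close>.
\<close>

lemma R_ge: "R t z - C * (\<Sum>s<t. avoidance_prob \<gamma> w {z} s x) \<le> R t x"
proof (induction t arbitrary: x)
  case (Suc t)
  show ?case
  proof (cases "x = z")
    case False
    let ?s = "avoidance_prob \<gamma> w {z}"
    have shift: "one_step \<gamma> w (?s s) x = ?s (Suc s) x" for s
      using False by (simp add: avoidance_prob_Suc killed_step_def)
    have "R (Suc t) z - C * (\<Sum>s<Suc t. ?s s x) = R (Suc t) z - C - C * (\<Sum>s<t. ?s (Suc s) x)"
      using False by (simp add: sum.lessThan_Suc_shift avoidance_prob_0 algebra_simps del: sum.lessThan_Suc)
    also have "\<dots> \<le> R t z + (- C) * (\<Sum>s<t. one_step \<gamma> w (?s s) x)"
      using growth[of t] by (simp add: shift)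
    also have "\<dots> = one_step \<gamma> w (\<lambda>x. R t z + (- C) * (\<Sum>s<t. ?s s x)) x"
      by (simp only: one_step_add one_step_const one_step_cmult one_step_sum)
    also have "\<dots> \<le> one_step \<gamma> w (R t) x"
      by (rule one_step_mono) (use Suc in simp)
    also have "\<dots> \<le> R (Suc t) x" by (simp add: R_Suc F_nonneg)
    finally show ?thesis .
  qed (simp add: avoidance_prob_on)
qed simp

lemma capped_reward_nonneg: "0 \<le> L \<Longrightarrow> 0 \<le> capped_reward \<gamma> w F A L t x"
  by (induction t arbitrary: x) (auto simp: F_nonneg R_nonneg intro!: add_nonneg_nonneg one_step_nonneg)

lemma capped_reward_le: "capped_reward \<gamma> w F A L t x \<le> R t x"
proof (induction t arbitrary: x)
  case (Suc t)
  have "one_step \<gamma> w (capped_reward \<gamma> w F A L t) x \<le> one_step \<gamma> w (R t) x"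
    by (rule one_step_mono) (rule Suc)
  then show ?case by (auto simp: R_Suc)
qed simp

end

text \<open>
  The reward accumulates along the walk \<open>w\<close>, while \<open>p\<close> is stationary for a walk \<open>wb\<close> that differs from
  \<open>w\<close> only on \<open>A\<close>. The rewards started in \<open>A\<close> exceed the one started in \<open>z\<close> by at most \<open>b\<close>,
  uniformly in \<open>t\<close>, and \<open>G\<close> bounds the effect of exchanging the two walks for one step.
\<close>

locale reward_comparison = reward_walk \<gamma> w F z C + bar: stationary_walk \<gamma> wb p
  for \<gamma> w F z C wb p +
  fixes A :: "state set" and b :: "state \<Rightarrow> real" and G :: "state \<Rightarrow> real"
  assumes recurrent: "\<And>x. (\<lambda>n. avoidance_prob \<gamma> w {z} n x) \<longlonglongrightarrow> 0"
    and z_in: "z \<in> A"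
    and agree: "\<And>x d. x \<notin> A \<Longrightarrow> d \<in> nbr x \<Longrightarrow> wb x d = w x d"
    and b_nonneg: "\<And>x. 0 \<le> b x"
    and b_finite: "finite_mean p (\<lambda>x. if x \<in> A then b x else 0)"
    and R_le_on: "\<And>t x. x \<in> A \<Longrightarrow> R t x \<le> R t z + b x"
    and G_finite: "finite_mean p G"
    and G_bound: "\<And>t x. \<bar>one_step \<gamma> wb (R t) x - one_step \<gamma> w (R t) x\<bar> \<le> G x"
begin

abbreviation "g \<equiv> expected_reward p G"

lemma one_step_agree: "x \<notin> A \<Longrightarrow> one_step \<gamma> wb f x = one_step \<gamma> w f x"
  by (rule one_step_cong) (rule agree)

lemma killed_step_agree: "killed_step \<gamma> wb A = killed_step \<gamma> w A"
  by (intro ext) (simp add: killed_step_def one_step_agree)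

text \<open>
  The functions that dominate the capped reward minus \<open>R t z\<close>. From a state outside \<open>A\<close> one step
  contributes \<open>L\<close>, and the value of \<open>b\<close> in case it enters \<open>A\<close>; this is \<open>gain\<close>, and \<open>excess\<close> adds it
  up along the path until \<open>A\<close> is reached.
\<close>

definition gain :: "real \<Rightarrow> state \<Rightarrow> real" where
  "gain L x = (if x \<in> A then 0 else L + one_step \<gamma> w (\<lambda>y. if y \<in> A then b y else 0) x)"

definition excess :: "real \<Rightarrow> nat \<Rightarrow> state \<Rightarrow> real" where
  "excess L t x = (if x \<in> A then b x else 0) + (\<Sum>s<t. (killed_step \<gamma> w A ^^ s) (gain L) x)"

lemma gain_nonneg: "0 \<le> L \<Longrightarrow> 0 \<le> gain L x"
  unfolding gain_def using b_nonneg by (auto intro!: add_nonneg_nonneg one_step_nonneg)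

lemma gain_finite:
  assumes "0 \<le> L"
  shows "finite_mean p (gain L)"
proof (rule bar.finite_mean_dominated)
  show "finite_mean p (\<lambda>x. L + one_step \<gamma> wb (\<lambda>y. if y \<in> A then b y else 0) x)"
    using b_nonneg by (intro mean_add(1) bar.mean_const bar.stationary_mean b_finite) auto
  have "0 \<le> one_step \<gamma> wb (\<lambda>y. if y \<in> A then b y else 0) x" for x
    using b_nonneg by (intro bar.one_step_nonneg) auto
  then show "\<bar>gain L x\<bar> \<le> L + one_step \<gamma> wb (\<lambda>y. if y \<in> A then b y else 0) x" for x
    using assms gain_nonneg[OF assms, of x] by (simp add: gain_def one_step_agree)
qed

lemma excess_finite:
  assumes "0 \<le> L"
  shows "finite_mean p (excess L t)"
    and "expected_reward p (excess L t) = expected_reward p (\<lambda>x. if x \<in> A then b x else 0)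
      + (\<Sum>s<t. expected_reward p ((killed_step \<gamma> w A ^^ s) (gain L)))"
proof -
  have "finite_mean p ((killed_step \<gamma> w A ^^ s) (gain L))" for s
    using bar.killed_power_mean[OF gain_nonneg[OF assms] gain_finite[OF assms], where A = A and n = s]
    by (simp add: killed_step_agree)
  note m = mean_sum[of t p "\<lambda>s. (killed_step \<gamma> w A ^^ s) (gain L)", OF this]
  show "finite_mean p (excess L t)"
    using mean_add(1)[OF b_finite m[THEN conjunct1]] by (simp add: excess_def)
  show "expected_reward p (excess L t) = expected_reward p (\<lambda>x. if x \<in> A then b x else 0)
      + (\<Sum>s<t. expected_reward p ((killed_step \<gamma> w A ^^ s) (gain L)))"
    using mean_add(2)[OF b_finite m[THEN conjunct1]] m by (simp add: excess_def[abs_def])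
qed

text \<open>
  Stopped on reaching \<open>A\<close>, the capped reward consists of at most \<open>L\<close> per time unit and of the true
  cumulative reward for a shorter horizon, which exceeds \<open>R t z\<close> by \<open>b\<close> at most.
\<close>

lemma capped_reward_le_excess:
  assumes L: "0 \<le> L"
  shows "capped_reward \<gamma> w F A L t x \<le> R t z + excess L t x"
proof (induction t arbitrary: x)
  case 0
  show ?case by (simp add: excess_def b_nonneg)
next
  case (Suc t)
  let ?K = "\<lambda>s. (killed_step \<gamma> w A ^^ s) (gain L)"
  let ?b = "\<lambda>y. if y \<in> A then b y else 0"
  have pos: "0 \<le> (\<Sum>s<n. ?K s x)" for n
    by (intro sum_nonneg killed_power_nonneg gain_nonneg L)
  show ?case
  proof (cases "x \<in> A")
    case True
    then show ?thesis using R_le_on[OF True, of "Suc t"] pos[of "Suc t"]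
      by (simp add: excess_def)
  next
    case False
    have "one_step \<gamma> w (capped_reward \<gamma> w F A L t) x \<le> one_step \<gamma> w (\<lambda>x. R t z + (?b x + (\<Sum>s<t. ?K s x))) x"
      by (rule one_step_mono) (use Suc in \<open>simp add: excess_def\<close>)
    also have "\<dots> = R t z + one_step \<gamma> w ?b x + (\<Sum>s<t. one_step \<gamma> w (?K s) x)"
      by (simp only: one_step_add one_step_const one_step_sum add.assoc)
    also have "(\<Sum>s<t. one_step \<gamma> w (?K s) x) = (\<Sum>s<t. ?K (Suc s) x)"
      using False by (simp add: killed_step_def)
    finally have "capped_reward \<gamma> w F A L (Suc t) x \<le> R t z + (gain L x + (\<Sum>s<t. ?K (Suc s) x))"
      using False by (simp add: gain_def)
    also have "gain L x + (\<Sum>s<t. ?K (Suc s) x) = excess L (Suc t) x"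
      using False by (simp add: excess_def sum.lessThan_Suc_shift del: sum.lessThan_Suc)
    finally show ?thesis using R_mono[of t z] by linarith
  qed
qed

text \<open>
  The mean excess is a sum over \<open>s < t\<close> of means of a fixed function over paths that have avoided
  \<open>A\<close> for \<open>s\<close> steps. These means tend to 0 by recurrence.
\<close>

lemma excess_sublinear:
  assumes L: "0 \<le> L" and \<epsilon>: "0 < \<epsilon>"
  shows "\<exists>D. \<forall>t. expected_reward p (excess L t) \<le> \<epsilon> * real t + D"
proof -
  have "(\<lambda>n. avoidance_prob \<gamma> w A n x) \<longlonglongrightarrow> 0" for x
    by (rule tendsto_sandwich[OF always_eventually always_eventually tendsto_const recurrent[of x]])
       (use z_in in \<open>auto intro: avoidance_prob_nonneg avoidance_prob_subset\<close>)
  moreover have "avoidance_prob \<gamma> wb A = avoidance_prob \<gamma> w A"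
    by (intro ext) (simp add: avoidance_prob_def killed_step_agree)
  ultimately have "(\<lambda>n. expected_reward p ((killed_step \<gamma> wb A ^^ n) (gain L))) \<longlonglongrightarrow> 0"
    by (intro bar.killed_power_mean_tendsto_0 gain_nonneg gain_finite L) (simp_all add: gain_def)
  from linear_bound_of_null_sequence[OF this \<epsilon>] obtain D
    where D: "\<And>t. (\<Sum>s<t. expected_reward p ((killed_step \<gamma> w A ^^ s) (gain L))) \<le> D + \<epsilon> * real t"
    by (auto simp: killed_step_agree)
  show ?thesis
    by (rule exI[of _ "expected_reward p (\<lambda>x. if x \<in> A then b x else 0) + D"])
       (use D in \<open>simp add: excess_finite(2)[OF L] algebra_simps\<close>)
qed

text \<open>
  Any reward \<open>f\<close> below the capped one will do. The capped cumulative reward is propagated by \<open>w\<close>, but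
  its mean only stays the same under a step of \<open>wb\<close>. Outside \<open>A\<close> the two walks make the same step.
  On \<open>A\<close> the capped cumulative reward is the true one, for which the exchange costs at most \<open>G\<close>. So
  the mean increases by at least that of \<open>f\<close> less \<open>g\<close> in every time unit.
\<close>

lemma capped_mean_le:
  assumes L: "0 \<le> L" and fL: "\<And>x. 0 \<le> f x" "\<And>x. f x \<le> F x" "\<And>x. f x \<le> L"
  shows "finite_mean p f"
    and "real t * expected_reward p f \<le> expected_reward p (capped_reward \<gamma> w F A L t) + real t * g"
proof -
  let ?U = "capped_reward \<gamma> w F A L"
  have U0: "0 \<le> ?U t x" for t x by (rule capped_reward_nonneg[OF L])
  have U: "finite_mean p (?U t)" for t
    by (rule bar.finite_mean_dominated[OF mean_add(1)[OF bar.mean_const(1) excess_finite(1)[OF L, of t]]])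
       (use U0 capped_reward_le_excess[OF L] in auto)
  note S = bar.stationary_mean[OF U0 U]
  have le: "f x \<le> ?U (Suc t) x - one_step \<gamma> wb (?U t) x + G x" for t x
  proof (cases "x \<in> A")
    case True
    have "one_step \<gamma> wb (?U t) x \<le> one_step \<gamma> wb (R t) x"
      by (rule bar.one_step_mono) (rule capped_reward_le)
    with True G_bound[of t x] fL(2)[of x] show ?thesis by (simp add: R_Suc)
  next
    case False
    with G_bound[of t x] fL(2,3)[of x] show ?thesis by (simp add: one_step_agree)
  qed
  show fin: "finite_mean p f"
    by (rule bar.finite_mean_dominated[OF mean_add(1)[OF mean_diff(1)[OF U[of "Suc 0"] S(1)[of 0]] G_finite]])
       (simp only: abs_of_nonneg[OF fL(1)] le)
  have step: "expected_reward p f \<le> expected_reward p (?U (Suc t)) - expected_reward p (?U t) + g" for t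
  proof -
    note D = mean_diff[OF U[of "Suc t"] S(1)[of t]]
    note E = mean_add[OF D(1) G_finite]
    show ?thesis
      using bar.mean_mono[OF fin E(1) le] E(2) D(2) S(2)[of t] by linarith
  qed
  show "real t * expected_reward p f \<le> expected_reward p (?U t) + real t * g"
  proof (induction t)
    case 0
    show ?case by (simp add: expected_reward_def)
  next
    case (Suc t)
    then show ?case using step[of t] by (simp add: algebra_simps del: capped_reward.simps(2))
  qed
qed

lemma capped_mean_le_growth:
  assumes L: "0 \<le> L" and fL: "\<And>x. 0 \<le> f x" "\<And>x. f x \<le> F x" "\<And>x. f x \<le> L" and \<epsilon>: "0 < \<epsilon>"
  shows "\<exists>D. \<forall>t. real t * expected_reward p f \<le> R t z + real t * (g + \<epsilon>) + D"
proof -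
  let ?U = "capped_reward \<gamma> w F A L"
  obtain D where D: "\<And>t. expected_reward p (excess L t) \<le> \<epsilon> * real t + D"
    using excess_sublinear[OF L \<epsilon>] by blast
  have "real t * expected_reward p f \<le> R t z + real t * (g + \<epsilon>) + D" for t
  proof -
    note M = mean_add[OF bar.mean_const(1)[of "R t z"] excess_finite(1)[OF L, of t]]
    have "finite_mean p (?U t)"
      by (rule bar.finite_mean_dominated[OF M(1)])
         (use capped_reward_nonneg[OF L] capped_reward_le_excess[OF L] in auto)
    from bar.mean_mono[OF this M(1) capped_reward_le_excess[OF L]]
    have "expected_reward p (?U t) \<le> R t z + expected_reward p (excess L t)"
      using M(2) bar.mean_const(2)[of "R t z"] by simp
    with capped_mean_le(2)[OF L fL, where t = t] D[of t]
    show ?thesis by (simp add: algebra_simps)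
  qed
  then show ?thesis by blast
qed

lemma finite_truncation:
  assumes "finite E"
  obtains L f where "0 \<le> L" "\<And>x. 0 \<le> f x" "\<And>x. f x \<le> F x" "\<And>x. f x \<le> L"
    and "expected_reward p f = (\<Sum>x\<in>E. p x * F x)"
proof -
  let ?f = "\<lambda>x. if x \<in> E then F x else 0"
  have "((\<lambda>x. p x * ?f x) has_sum (\<Sum>x\<in>E. p x * F x)) UNIV"
    by (rule has_sum_cong_neutral[THEN iffD1, OF _ _ _ has_sum_finite[OF assms, of "\<lambda>x. p x * F x"]]) auto
  then have "expected_reward p ?f = (\<Sum>x\<in>E. p x * F x)"
    unfolding expected_reward_def by (rule infsumI)
  moreover have "?f x \<le> (\<Sum>x\<in>E. F x)" for x
    using member_le_sum[of x E F] assms F_nonneg sum_nonneg[of E F] by auto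
  ultimately show ?thesis
    by (intro that[of "\<Sum>x\<in>E. F x" ?f]) (auto simp: F_nonneg intro: sum_nonneg)
qed

text \<open>
  The means of the finite truncations of \<open>F\<close> grow no faster than \<open>R t z\<close>, up to \<open>t * (g + 1)\<close>, and the
  linear bound on \<open>R t z\<close> does not depend on the truncation.
\<close>

lemma F_finite: "finite_mean p F"
proof (rule nonneg_bdd_above_summable_on)
  show "0 \<le> p x * F x" for x by (simp add: bar.p_nonneg F_nonneg)
  have "(\<Sum>x\<in>E. p x * F x) \<le> C + (g + 1)" if E: "finite E" for E
  proof -
    obtain L f where L: "0 \<le> L" "\<And>x. 0 \<le> f x" "\<And>x. f x \<le> F x" "\<And>x. f x \<le> L"
      and m: "expected_reward p f = (\<Sum>x\<in>E. p x * F x)"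
      using finite_truncation[OF E] by blast
    obtain D where D: "\<And>t. real t * expected_reward p f \<le> R t z + real t * (g + 1) + D"
      using capped_mean_le_growth[OF L, of 1] by auto
    have "real t * expected_reward p f \<le> real t * (C + (g + 1)) + D" for t
      using D[of t] R_le_linear[of t] by (simp add: algebra_simps)
    then show ?thesis unfolding m[symmetric] by (rule le_of_linear_bound)
  qed
  then show "bdd_above (sum (\<lambda>x. p x * F x) ` {E. E \<subseteq> UNIV \<and> finite E})"
    by (intro bdd_aboveI[of _ "C + (g + 1)"]) auto
qed

lemma mean_le_growth:
  assumes \<epsilon>: "0 < \<epsilon>"
  shows "\<exists>D. \<forall>t. real t * expected_reward p F \<le> R t z + real t * (g + \<epsilon>) + D"
proof -
  obtain E where E: "finite E" "expected_reward p F - (\<Sum>x\<in>E. p x * F x) \<le> \<epsilon>/2"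
    using bar.mean_approx_finite[OF F_finite, of "\<epsilon>/2"] \<epsilon> by auto
  obtain L f where L: "0 \<le> L" "\<And>x. 0 \<le> f x" "\<And>x. f x \<le> F x" "\<And>x. f x \<le> L"
    and m: "expected_reward p f = (\<Sum>x\<in>E. p x * F x)"
    using finite_truncation[OF E(1)] by blast
  obtain D where D: "\<And>t. real t * expected_reward p f \<le> R t z + real t * (g + \<epsilon>/2) + D"
    using capped_mean_le_growth[OF L, of "\<epsilon>/2"] \<epsilon> by auto
  have "real t * expected_reward p F \<le> R t z + real t * (g + \<epsilon>) + D" for t
  proof -
    have "real t * expected_reward p F \<le> real t * (expected_reward p f + \<epsilon>/2)"
      using E(2) m by (intro mult_left_mono) auto
    with D[of t] show ?thesis by (simp add: algebra_simps)
  qed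
  then show ?thesis by blast
qed

text \<open>
  With the summability of \<open>F\<close> established, stationarity applies to the true cumulative reward.
\<close>

lemma R_finite_and_mean:
  "finite_mean p (R t) \<and> expected_reward p (R t) \<le> real t * expected_reward p F + real t * g"
proof (induction t)
  case 0
  show ?case by (simp add: expected_reward_def)
next
  case (Suc t)
  then have fin: "finite_mean p (R t)" by simp
  note S = bar.stationary_mean[OF R_nonneg fin]
  note M = mean_add[OF S(1) G_finite]
  have "one_step \<gamma> w (R t) x \<le> one_step \<gamma> wb (R t) x + G x" for x
    using G_bound[of t x] by linarith
  then have le: "R (Suc t) x \<le> F x + (one_step \<gamma> wb (R t) x + G x)" for x
    by (simp add: R_Suc)
  note N = mean_add[OF F_finite M(1)]
  have fin': "finite_mean p (R (Suc t))"
    by (rule bar.finite_mean_dominated[OF N(1)]) (use le R_nonneg[of "Suc t"] in auto)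
  have "expected_reward p (R (Suc t)) \<le> expected_reward p F + (expected_reward p (R t) + g)"
    using bar.mean_mono[OF fin' N(1) le] N(2) M(2) S(2) by simp
  with Suc fin' show ?case by (simp add: algebra_simps)
qed

lemma growth_le_mean:
  assumes \<epsilon>: "0 < \<epsilon>"
  shows "\<exists>D. \<forall>t. R t z \<le> real t * expected_reward p F + real t * (g + \<epsilon>) + D"
proof -
  let ?s = "avoidance_prob \<gamma> w {z}"
  have s_fin: "finite_mean p (?s n)" for n
    by (rule bar.finite_mean_dominated[OF bar.mean_const(1)[of 1]])
       (simp add: avoidance_prob_nonneg avoidance_prob_le_1)
  have "(\<lambda>n. C * expected_reward p (?s n)) \<longlonglongrightarrow> C * 0"
    by (intro tendsto_intros bar.mean_bounded_convergence avoidance_prob_nonneg avoidance_prob_le_1 recurrent)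
  then obtain D where D: "\<And>t. (\<Sum>s<t. C * expected_reward p (?s s)) \<le> D + \<epsilon> * real t"
    using linear_bound_of_null_sequence[OF _ \<epsilon>] by fastforce
  have "R t z \<le> real t * expected_reward p F + real t * (g + \<epsilon>) + D" for t
  proof -
    note M = mean_sum[of t p "\<lambda>s. ?s s", OF s_fin]
    note M' = mean_cmult[OF M[THEN conjunct1], of C]
    note N = mean_diff[OF bar.mean_const(1)[of "R t z"] M'(1)]
    have "R t z - C * (\<Sum>s<t. expected_reward p (?s s)) \<le> expected_reward p (R t)"
      using bar.mean_mono[OF N(1) R_finite_and_mean[THEN conjunct1] R_ge]
        N(2) M'(2) M bar.mean_const(2)[of "R t z"] by simp
    then show ?thesis
      using R_finite_and_mean[of t] D[of t] by (simp add: sum_distrib_left algebra_simps)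
  qed
  then show ?thesis by blast
qed

theorem mean_growth:
  assumes "0 < \<epsilon>"
  shows "\<exists>D. \<forall>t. \<bar>real t * expected_reward p F - R t z\<bar> \<le> real t * (g + \<epsilon>) + D"
proof -
  obtain D1 D2 where
    "\<And>t. real t * expected_reward p F \<le> R t z + real t * (g + \<epsilon>) + D1"
    "\<And>t. R t z \<le> real t * expected_reward p F + real t * (g + \<epsilon>) + D2"
    using mean_le_growth[OF assms] growth_le_mean[OF assms] by blast
  then have "\<bar>real t * expected_reward p F - R t z\<bar> \<le> real t * (g + \<epsilon>) + max D1 D2" for t
    by (smt (verit))
  then show ?thesis by blast
qed

end

section \<open>Stationarity of the sum of geometric terms\<close>

lemma steps_explicit:
  "N1 = {(-1, 0), (-1, 1), (0, 1), (1, 0), (1, 1)}"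
  "N2 = {(0, -1), (1, -1), (1, 0), (0, 1), (1, 1)}"
  "N3 = {(0, 1), (1, 0), (1, 1)}"
  "N4 = {(-1, -1), (-1, 0), (-1, 1), (0, -1), (0, 1), (1, -1), (1, 0), (1, 1)}"
  by (auto simp: N1_def N2_def N3_def N4_def)

lemma unit_steps: "{-1..1} = {-1, 0, 1 :: int}"
  by auto

lemma interior_balance_polynomial:
  assumes "interior_balance q \<rho> \<sigma>" and nz: "\<rho> \<noteq> 0" "\<sigma> \<noteq> 0"
    and q00: "q 0 0 = - (\<Sum>(i, j)\<in>N4. q i j)"
  shows "\<rho>^2 * \<sigma>^2 * q (-1) (-1) + \<rho>^2 * \<sigma> * q (-1) 0 + \<rho>^2 * q (-1) 1
    + \<rho> * \<sigma>^2 * q 0 (-1) + \<rho> * q 0 1 + \<sigma>^2 * q 1 (-1) + \<sigma> * q 1 0 + q 1 1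
    = \<rho> * \<sigma> * (q (-1) (-1) + q (-1) 0 + q (-1) 1
      + q 0 (-1) + q 0 1 + q 1 (-1) + q 1 0 + q 1 1)"
proof -
  define a b where "a = inverse \<rho>" and "b = inverse \<sigma>"
  have "\<rho> * a = 1" "\<sigma> * b = 1" using nz by (simp_all add: a_def b_def)
  moreover have "\<rho> * \<sigma> * q (-1) (-1) + \<rho> * q (-1) 0 + \<rho> * b * q (-1) 1
      + \<sigma> * q 0 (-1) + q 0 0 + b * q 0 1 + a * \<sigma> * q 1 (-1) + a * q 1 0 + a * b * q 1 1 = 0"
    using assms(1) by (simp add: interior_balance_def unit_steps power_int_minus a_def b_def)
  moreover have "q 0 0 = - (q (-1) (-1) + q (-1) 0 + q (-1) 1
      + q 0 (-1) + q 0 1 + q 1 (-1) + q 1 0 + q 1 1)"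
    by (simp add: q00 steps_explicit)
  ultimately show ?thesis by algebra
qed

lemma alpha_times:
  assumes "\<rho> \<noteq> 0"
  shows "\<rho> * alpha q \<rho> \<sigma> = \<rho> * (q (-1) 1 + q 0 1 + q 1 1)
    - \<sigma> * (\<rho>^2 * q (-1) (-1) + \<rho> * q 0 (-1) + q 1 (-1))"
  using assms by (simp add: alpha_def unit_steps power_int_minus field_simps power2_eq_square)

lemma beta_times:
  assumes "\<sigma> \<noteq> 0"
  shows "\<sigma> * beta q \<rho> \<sigma> = \<sigma> * (q 1 (-1) + q 1 0 + q 1 1)
    - \<rho> * (\<sigma>^2 * q (-1) (-1) + \<sigma> * q (-1) 0 + q (-1) 1)"
  using assms by (simp add: beta_def unit_steps power_int_minus field_simps power2_eq_square)

text \<open>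
  With the axis flows of the construction, each single geometric term balances in the origin: if
  the flows of a summable measure balance in every state but one, they balance there as well.
  Algebraically, the equation multiplied by \<open>(1 - \<rho>) * (1 - \<sigma>)\<close> is the interior balance equation
  multiplied by \<open>\<rho> * \<sigma>\<close>.
\<close>

lemma origin_balance_term:
  assumes bal: "interior_balance q \<rho> \<sigma>" and range: "\<rho> \<in> {0<..<1}" "\<sigma> \<in> {0<..<1}"
    and q00: "q 0 0 = - (\<Sum>(i, j)\<in>N4. q i j)"
  shows "q 1 1 + alpha q \<rho> \<sigma> * inverse (1 - \<rho>) * \<rho> + beta q \<rho> \<sigma> * inverse (1 - \<sigma>) * \<sigma>
    = \<rho> * \<sigma> * q (-1) (-1)"
proof -
  have nz: "\<rho> \<noteq> 0" "\<sigma> \<noteq> 0" "1 - \<rho> \<noteq> 0" "1 - \<sigma> \<noteq> 0" using range by auto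
  have "(q 1 1 - \<rho> * \<sigma> * q (-1) (-1)) * ((1 - \<rho>) * (1 - \<sigma>))
      + (\<rho> * alpha q \<rho> \<sigma>) * (1 - \<sigma>) + (\<sigma> * beta q \<rho> \<sigma>) * (1 - \<rho>) = 0"
    using interior_balance_polynomial[OF bal nz(1,2) q00]
    unfolding alpha_times[OF nz(1)] beta_times[OF nz(2)] by algebra
  moreover have "(1 - \<rho>) * inverse (1 - \<rho>) = 1" "(1 - \<sigma>) * inverse (1 - \<sigma>) = 1"
    using nz by simp_all
  ultimately show ?thesis by algebra
qed

lemma geometric_difference:
  fixes x y :: real
  assumes "1 - x \<noteq> 0"
  shows "y * inverse (1 - x) * x ^ Suc n - y * inverse (1 - x) * x ^ Suc (Suc n) = x ^ n * (x * y)"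
proof -
  have "y * inverse (1 - x) * x ^ Suc n - y * inverse (1 - x) * x ^ Suc (Suc n)
    = (inverse (1 - x) * (1 - x)) * (x ^ n * (x * y))"
    by (simp add: algebra_simps)
  then show ?thesis using assms by simp
qed

lemma move_steps:
  "move (m, n) (1, 0) = (Suc m, n)" "move (m, n) (0, 1) = (m, Suc n)"
  "move (m, n) (1, 1) = (Suc m, Suc n)"
  "move (Suc m, n) (-1, 0) = (m, n)" "move (Suc m, n) (-1, 1) = (m, Suc n)"
  "move (m, Suc n) (0, -1) = (m, n)" "move (m, Suc n) (1, -1) = (Suc m, n)"
  "move (Suc m, Suc n) (-1, -1) = (m, n)"
  by (simp_all add: move_def nat_add_distrib)

locale geometric_construction =
  fixes K :: nat and c \<rho> \<sigma> :: "nat \<Rightarrow> real" and q :: "int \<Rightarrow> int \<Rightarrow> real" and h10 v01 :: real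
  assumes q00: "q 0 0 = - (\<Sum>(i, j)\<in>N4. q i j)"
    and range: "\<And>k. k \<in> {1..K} \<Longrightarrow> \<rho> k \<in> {0<..<1} \<and> \<sigma> k \<in> {0<..<1}"
    and prob: "prob_distribution (geometric_sum K c \<rho> \<sigma>)"
    and bal: "\<And>k. k \<in> {1..K} \<Longrightarrow> interior_balance q (\<rho> k) (\<sigma> k)"
    and well_defined: "construction_well_defined K c \<rho> \<sigma>"
begin

abbreviation "p \<equiv> geometric_sum K c \<rho> \<sigma>"
abbreviation "wb \<equiv> bar_walk K c \<rho> \<sigma> q h10 v01"
abbreviation "left \<equiv> bar_h_left K c \<rho> \<sigma> q h10"
abbreviation "down \<equiv> bar_v_down K c \<rho> \<sigma> q v01"

lemma wb_simps:
  "wb (Suc a, Suc b) (i, j) = q i j"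
  "wb (Suc a, 0) (i, 1) = q i 1"
  "wb (Suc a, 0) (1, 0) = h10"
  "wb (Suc a, 0) (-1, 0) = left (Suc a)"
  "wb (0, Suc a) (1, j) = q 1 j"
  "wb (0, Suc a) (0, 1) = v01"
  "wb (0, Suc a) (0, -1) = down (Suc a)"
  "wb (0, 0) (1, 0) = h10"
  "wb (0, 0) (0, 1) = v01"
  "wb (0, 0) (1, 1) = q 1 1"
  by (simp_all add: bar_walk_def quadrant_walk_def bar_h_def bar_v_def bar_r_def)

text \<open>
  The denominator of the rate is the probability of the state, so that the flow is again a sum of
  geometric terms.
\<close>

lemma left_flow: "p (Suc n, 0) * left (Suc n) = h10 * p (n, 0)
    - (\<Sum>k=1..K. c k * alpha q (\<rho> k) (\<sigma> k) * inverse (1 - \<rho> k) * \<rho> k ^ Suc n)"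
proof -
  have "(\<Sum>k=1..K. c k * \<rho> k ^ Suc n) \<noteq> 0"
    using well_defined unfolding construction_well_defined_def by (metis le_add1 plus_1_eq_Suc)
  then show ?thesis
    by (simp add: geometric_sum_def bar_h_left_def right_diff_distrib del: power_Suc)
qed

lemma down_flow: "p (0, Suc n) * down (Suc n) = v01 * p (0, n)
    - (\<Sum>k=1..K. c k * beta q (\<rho> k) (\<sigma> k) * inverse (1 - \<sigma> k) * \<sigma> k ^ Suc n)"
proof -
  have "(\<Sum>k=1..K. c k * \<sigma> k ^ Suc n) \<noteq> 0"
    using well_defined unfolding construction_well_defined_def by (metis le_add1 plus_1_eq_Suc)
  then show ?thesis
    by (simp add: geometric_sum_def bar_v_down_def right_diff_distrib del: power_Suc)
qed

lemma balance_interior: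
  "p (Suc a, Suc b) * exit_rate wb (Suc a, Suc b)
    = (\<Sum>e\<in>nbr (Suc a, Suc b). p (move (Suc a, Suc b) e) * wb (move (Suc a, Suc b) e) (- e))"
proof -
  have wb: "wb (a, b) (1, 1) = q 1 1" "wb (a, Suc b) (1, j) = q 1 j" "wb (Suc a, b) (i, 1) = q i 1"
    "wb (a, Suc (Suc b)) (1, j) = q 1 j" "wb (Suc (Suc a), b) (i, 1) = q i 1" for i j
    by (cases a; cases b; simp add: wb_simps)+
  have "c k * \<rho> k ^ Suc a * \<sigma> k ^ Suc b * (q (-1) (-1) + q (-1) 0 + q (-1) 1
      + q 0 (-1) + q 0 1 + q 1 (-1) + q 1 0 + q 1 1)
     = c k * \<rho> k ^ a * \<sigma> k ^ b * q 1 1 + c k * \<rho> k ^ a * \<sigma> k ^ Suc b * q 1 0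
     + c k * \<rho> k ^ a * \<sigma> k ^ Suc (Suc b) * q 1 (-1)
     + c k * \<rho> k ^ Suc a * \<sigma> k ^ b * q 0 1 + c k * \<rho> k ^ Suc a * \<sigma> k ^ Suc (Suc b) * q 0 (-1)
     + c k * \<rho> k ^ Suc (Suc a) * \<sigma> k ^ b * q (-1) 1 + c k * \<rho> k ^ Suc (Suc a) * \<sigma> k ^ Suc b * q (-1) 0
     + c k * \<rho> k ^ Suc (Suc a) * \<sigma> k ^ Suc (Suc b) * q (-1) (-1)" if "k \<in> {1..K}" for k
  proof -
    have "c k * \<rho> k ^ a * \<sigma> k ^ b * (\<rho> k * \<sigma> k * (q (-1) (-1) + q (-1) 0 + q (-1) 1
      + q 0 (-1) + q 0 1 + q 1 (-1) + q 1 0 + q 1 1))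
      = c k * \<rho> k ^ a * \<sigma> k ^ b * (\<rho> k^2 * \<sigma> k^2 * q (-1) (-1) + \<rho> k^2 * \<sigma> k * q (-1) 0 + \<rho> k^2 * q (-1) 1
    + \<rho> k * \<sigma> k^2 * q 0 (-1) + \<rho> k * q 0 1 + \<sigma> k^2 * q 1 (-1) + \<sigma> k * q 1 0 + q 1 1)"
      using interior_balance_polynomial[OF bal[OF that] _ _ q00] range[OF that] by simp
    then show ?thesis by (simp add: algebra_simps power2_eq_square)
  qed
  note sum.cong[of "{1..K}" "{1..K}", OF refl this]
  then have "p (Suc a, Suc b) * (q (-1) (-1) + q (-1) 0 + q (-1) 1
      + q 0 (-1) + q 0 1 + q 1 (-1) + q 1 0 + q 1 1)
     = p (a, b) * q 1 1 + p (a, Suc b) * q 1 0 + p (a, Suc (Suc b)) * q 1 (-1)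
     + p (Suc a, b) * q 0 1 + p (Suc a, Suc (Suc b)) * q 0 (-1)
     + p (Suc (Suc a), b) * q (-1) 1 + p (Suc (Suc a), Suc b) * q (-1) 0
     + p (Suc (Suc a), Suc (Suc b)) * q (-1) (-1)"
    by (simp only: sum.distrib geometric_sum_def fst_conv snd_conv sum_distrib_right)
  then show ?thesis
    by (simp add: exit_rate_def nbr_eq steps_explicit move_steps wb wb_simps algebra_simps)
qed

text \<open>
  On an axis the flows towards the origin telescope: by \<open>left_flow\<close> the flows in and out by the step
  \<open>(-1, 0)\<close>, together with those by \<open>(1, 0)\<close>, leave the sum of \<open>c k * alpha * \<rho> k ^ n\<close>, and \<open>alpha\<close> is
  by definition the surplus of the upward over the downward flow.
\<close>

lemma balance_horizontal:
  "p (Suc a, 0) * exit_rate wb (Suc a, 0)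
    = (\<Sum>e\<in>nbr (Suc a, 0). p (move (Suc a, 0) e) * wb (move (Suc a, 0) e) (- e))"
proof -
  have wb: "wb (a, 0) (1, 0) = h10" "wb (a, Suc 0) (1, -1) = q 1 (-1)"
    by (cases a; simp add: wb_simps)+
  have "c k * \<rho> k ^ Suc a * (q (-1) 1 + q 0 1 + q 1 1)
      - c k * alpha q (\<rho> k) (\<sigma> k) * inverse (1 - \<rho> k) * \<rho> k ^ Suc a
    = c k * \<rho> k ^ a * \<sigma> k * q 1 (-1) + c k * \<rho> k ^ Suc a * \<sigma> k * q 0 (-1)
      + c k * \<rho> k ^ Suc (Suc a) * \<sigma> k * q (-1) (-1)
      - c k * alpha q (\<rho> k) (\<sigma> k) * inverse (1 - \<rho> k) * \<rho> k ^ Suc (Suc a)" if "k \<in> {1..K}" for k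
  proof -
    have nz: "\<rho> k \<noteq> 0" "1 - \<rho> k \<noteq> 0" using range[OF that] by auto
    have "alpha q (\<rho> k) (\<sigma> k) * inverse (1 - \<rho> k) * \<rho> k ^ Suc a
        - alpha q (\<rho> k) (\<sigma> k) * inverse (1 - \<rho> k) * \<rho> k ^ Suc (Suc a)
      = \<rho> k ^ a * (\<rho> k * alpha q (\<rho> k) (\<sigma> k))"
      by (rule geometric_difference[OF nz(2)])
    also have "\<dots> = \<rho> k ^ a * (\<rho> k * (q (-1) 1 + q 0 1 + q 1 1)
    - \<sigma> k * (\<rho> k^2 * q (-1) (-1) + \<rho> k * q 0 (-1) + q 1 (-1)))"
      by (simp only: alpha_times[OF nz(1)])
    finally have "c k * (alpha q (\<rho> k) (\<sigma> k) * inverse (1 - \<rho> k) * \<rho> k ^ Suc a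
        - alpha q (\<rho> k) (\<sigma> k) * inverse (1 - \<rho> k) * \<rho> k ^ Suc (Suc a))
      = c k * (\<rho> k ^ a * (\<rho> k * (q (-1) 1 + q 0 1 + q 1 1)
    - \<sigma> k * (\<rho> k^2 * q (-1) (-1) + \<rho> k * q 0 (-1) + q 1 (-1))))" by (simp only:)
    then show ?thesis by (simp add: algebra_simps power2_eq_square)
  qed
  note sum.cong[of "{1..K}" "{1..K}", OF refl this]
  then have "p (Suc a, 0) * (q (-1) 1 + q 0 1 + q 1 1)
      - (\<Sum>k=1..K. c k * alpha q (\<rho> k) (\<sigma> k) * inverse (1 - \<rho> k) * \<rho> k ^ Suc a)
    = p (a, Suc 0) * q 1 (-1) + p (Suc a, Suc 0) * q 0 (-1) + p (Suc (Suc a), Suc 0) * q (-1) (-1)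
      - (\<Sum>k=1..K. c k * alpha q (\<rho> k) (\<sigma> k) * inverse (1 - \<rho> k) * \<rho> k ^ Suc (Suc a))"
    by (simp only: sum.distrib sum_subtractf geometric_sum_def fst_conv snd_conv sum_distrib_right)
       (simp add: mult_ac)
  then have "p (Suc a, 0) * (q (-1) 1 + q 0 1 + q 1 1 + h10) + p (Suc a, 0) * left (Suc a)
    = p (a, 0) * h10 + p (a, Suc 0) * q 1 (-1) + p (Suc a, Suc 0) * q 0 (-1)
      + p (Suc (Suc a), Suc 0) * q (-1) (-1) + p (Suc (Suc a), 0) * left (Suc (Suc a))"
    unfolding left_flow by (simp add: algebra_simps)
  then show ?thesis
    by (simp add: exit_rate_def nbr_eq steps_explicit move_steps wb wb_simps algebra_simps)
qed

lemma balance_vertical: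
  "p (0, Suc a) * exit_rate wb (0, Suc a)
    = (\<Sum>e\<in>nbr (0, Suc a). p (move (0, Suc a) e) * wb (move (0, Suc a) e) (- e))"
proof -
  have wb: "wb (0, a) (0, 1) = v01" "wb (Suc 0, a) (-1, 1) = q (-1) 1"
    by (cases a; simp add: wb_simps)+
  have "c k * \<sigma> k ^ Suc a * (q 1 (-1) + q 1 0 + q 1 1)
      - c k * beta q (\<rho> k) (\<sigma> k) * inverse (1 - \<sigma> k) * \<sigma> k ^ Suc a
    = c k * \<rho> k * \<sigma> k ^ a * q (-1) 1 + c k * \<rho> k * \<sigma> k ^ Suc a * q (-1) 0
      + c k * \<rho> k * \<sigma> k ^ Suc (Suc a) * q (-1) (-1)
      - c k * beta q (\<rho> k) (\<sigma> k) * inverse (1 - \<sigma> k) * \<sigma> k ^ Suc (Suc a)" if "k \<in> {1..K}" for k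
  proof -
    have nz: "\<sigma> k \<noteq> 0" "1 - \<sigma> k \<noteq> 0" using range[OF that] by auto
    have "beta q (\<rho> k) (\<sigma> k) * inverse (1 - \<sigma> k) * \<sigma> k ^ Suc a
        - beta q (\<rho> k) (\<sigma> k) * inverse (1 - \<sigma> k) * \<sigma> k ^ Suc (Suc a)
      = \<sigma> k ^ a * (\<sigma> k * beta q (\<rho> k) (\<sigma> k))"
      by (rule geometric_difference[OF nz(2)])
    also have "\<dots> = \<sigma> k ^ a * (\<sigma> k * (q 1 (-1) + q 1 0 + q 1 1)
    - \<rho> k * (\<sigma> k^2 * q (-1) (-1) + \<sigma> k * q (-1) 0 + q (-1) 1))"
      by (simp only: beta_times[OF nz(1)])
    finally have "c k * (beta q (\<rho> k) (\<sigma> k) * inverse (1 - \<sigma> k) * \<sigma> k ^ Suc a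
        - beta q (\<rho> k) (\<sigma> k) * inverse (1 - \<sigma> k) * \<sigma> k ^ Suc (Suc a))
      = c k * (\<sigma> k ^ a * (\<sigma> k * (q 1 (-1) + q 1 0 + q 1 1)
    - \<rho> k * (\<sigma> k^2 * q (-1) (-1) + \<sigma> k * q (-1) 0 + q (-1) 1)))" by (simp only:)
    then show ?thesis by (simp add: algebra_simps power2_eq_square)
  qed
  note sum.cong[of "{1..K}" "{1..K}", OF refl this]
  then have "p (0, Suc a) * (q 1 (-1) + q 1 0 + q 1 1)
      - (\<Sum>k=1..K. c k * beta q (\<rho> k) (\<sigma> k) * inverse (1 - \<sigma> k) * \<sigma> k ^ Suc a)
    = p (Suc 0, a) * q (-1) 1 + p (Suc 0, Suc a) * q (-1) 0 + p (Suc 0, Suc (Suc a)) * q (-1) (-1)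
      - (\<Sum>k=1..K. c k * beta q (\<rho> k) (\<sigma> k) * inverse (1 - \<sigma> k) * \<sigma> k ^ Suc (Suc a))"
    by (simp only: sum.distrib sum_subtractf geometric_sum_def fst_conv snd_conv sum_distrib_right)
       (simp add: mult_ac)
  then have "p (0, Suc a) * (q 1 (-1) + q 1 0 + q 1 1 + v01) + p (0, Suc a) * down (Suc a)
    = p (0, a) * v01 + p (Suc 0, a) * q (-1) 1 + p (Suc 0, Suc a) * q (-1) 0
      + p (Suc 0, Suc (Suc a)) * q (-1) (-1) + p (0, Suc (Suc a)) * down (Suc (Suc a))"
    unfolding down_flow by (simp add: algebra_simps)
  then show ?thesis
    by (simp add: exit_rate_def nbr_eq steps_explicit move_steps wb wb_simps algebra_simps)
qed

lemma balance_origin: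
  "p (0, 0) * exit_rate wb (0, 0)
    = (\<Sum>e\<in>nbr (0, 0). p (move (0, 0) e) * wb (move (0, 0) e) (- e))"
proof -
  have "c k * (q 1 1 + alpha q (\<rho> k) (\<sigma> k) * inverse (1 - \<rho> k) * \<rho> k
      + beta q (\<rho> k) (\<sigma> k) * inverse (1 - \<sigma> k) * \<sigma> k)
    = c k * (\<rho> k * \<sigma> k * q (-1) (-1))" if "k \<in> {1..K}" for k
    using origin_balance_term[OF bal[OF that] _ _ q00] range[OF that] by simp
  note sum.cong[of "{1..K}" "{1..K}", OF refl this, of "\<lambda>k. k"]
  then have "p (0, 0) * q 1 1 = p (Suc 0, Suc 0) * q (-1) (-1)
      - (\<Sum>k=1..K. c k * alpha q (\<rho> k) (\<sigma> k) * inverse (1 - \<rho> k) * \<rho> k ^ Suc 0)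
      - (\<Sum>k=1..K. c k * beta q (\<rho> k) (\<sigma> k) * inverse (1 - \<sigma> k) * \<sigma> k ^ Suc 0)"
    by (simp add: geometric_sum_def sum_distrib_right sum.distrib distrib_left mult.assoc)
  then have "p (0, 0) * (h10 + v01 + q 1 1) = p (Suc 0, Suc 0) * q (-1) (-1)
      + p (Suc 0, 0) * left (Suc 0) + p (0, Suc 0) * down (Suc 0)"
    unfolding left_flow down_flow by (simp add: algebra_simps)
  then show ?thesis
    by (simp add: exit_rate_def nbr_eq steps_explicit move_steps wb_simps algebra_simps)
qed

lemma stationary_geometric_sum: "stationary_distribution wb p"
proof -
  have "p y * exit_rate wb y = (\<Sum>e\<in>nbr y. p (move y e) * wb (move y e) (- e))" for y
  proof -
    obtain m n where y: "y = (m, n)" by (cases y)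
    show ?thesis unfolding y
      by (cases m; cases n; simp only: balance_interior balance_horizontal balance_vertical balance_origin)
  qed
  then show ?thesis
    using prob unfolding stationary_distribution_def sum_incoming by blast
qed

end

section \<open>Polylogarithms of nonpositive order\<close>

lemma summable_power_times_geometric:
  fixes z :: real
  assumes "\<bar>z\<bar> < 1"
  shows "summable (\<lambda>n. real n ^ m * z ^ n)"
  using assms
proof (induction m arbitrary: z)
  case 0
  then show ?case by (simp add: summable_geometric)
next
  case (Suc m)
  have "summable (\<lambda>n. diffs (\<lambda>n. real n ^ m) n * z ^ n)"
    by (rule termdiff_converges[where K = 1]) (use Suc in auto)
  then have "summable (\<lambda>n. z * (diffs (\<lambda>n. real n ^ m) n * z ^ n))"
    by (rule summable_mult)
  then have "summable (\<lambda>n. real (Suc n) ^ Suc m * z ^ Suc n)"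
    by (simp add: diffs_def mult_ac)
  then show ?case by (subst (asm) summable_Suc_iff)
qed

lemma polylog_sums:
  fixes z :: real
  assumes "0 < z" "z < 1"
  shows "(\<lambda>n. real (Suc n) ^ m * z ^ Suc n) sums polylog (- int m) z"
proof -
  have "polylog (- int m) z = (\<Sum>n. real (Suc n) ^ m * z ^ Suc n)"
    unfolding polylog_def by (simp add: power_int_minus divide_inverse mult.commute)
  then show ?thesis
    using summable_power_times_geometric[of z m] assms
    by (simp only: summable_sums summable_Suc_iff[of "\<lambda>n. real n ^ m * z ^ n"] abs_of_pos)
qed

lemma sums_polynomial_geometric:
  assumes range: "\<And>k. k \<in> {1..K} \<Longrightarrow> 0 < z k \<and> z k < (1::real)"
  shows "(\<lambda>n. (\<Sum>k=1..K. a k * z k ^ Suc n) * (\<Sum>m=0..M. b m * real (Suc n) ^ m))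
    sums (\<Sum>k=1..K. \<Sum>m=0..M. a k * b m * polylog (- int m) (z k))"
proof -
  have "(\<lambda>n. \<Sum>k=1..K. \<Sum>m=0..M. a k * b m * (real (Suc n) ^ m * z k ^ Suc n))
    sums (\<Sum>k=1..K. \<Sum>m=0..M. a k * b m * polylog (- int m) (z k))"
    by (intro sums_sum sums_mult polylog_sums) (use range in auto)
  moreover have "(\<Sum>k=1..K. a k * z k ^ Suc n) * (\<Sum>m=0..M. b m * real (Suc n) ^ m)
    = (\<Sum>k=1..K. \<Sum>m=0..M. a k * b m * (real (Suc n) ^ m * z k ^ Suc n))" for n
    by (simp only: sum_product) (simp add: mult_ac)
  ultimately show ?thesis by simp
qed

text \<open>
  Here \<open>D\<close> collects the rate differences that do not depend on the position \<open>Suc n\<close> on the axis,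
  and the remaining terms are the flow of the construction towards the origin.
\<close>

lemma axis_sums:
  assumes range: "\<And>k. k \<in> {1..K} \<Longrightarrow> 0 < z k \<and> z k < (1::real)"
  shows "(\<lambda>n. (D * (\<Sum>k=1..K. c k * z k ^ Suc n) + (e * (\<Sum>k=1..K. c k * z k ^ n)
        - (\<Sum>k=1..K. c k * a k * inverse (1 - z k) * z k ^ Suc n)))
      * (\<Sum>m=0..M. b m * real (Suc n) ^ m))
    sums (D * (\<Sum>k=1..K. \<Sum>m=0..M. c k * b m * polylog (- int m) (z k))
      + e * (\<Sum>k=1..K. \<Sum>m=0..M. c k * inverse (z k) * b m * polylog (- int m) (z k))
      - (\<Sum>k=1..K. \<Sum>m=0..M. c k * a k * b m * inverse (1 - z k) * polylog (- int m) (z k)))"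
proof -
  note S = sums_polynomial_geometric[where z = z and K = K and b = b and M = M, OF range]
  have shift: "(\<Sum>k=1..K. c k * z k ^ n) = (\<Sum>k=1..K. c k * inverse (z k) * z k ^ Suc n)" for n
    by (rule sum.cong) (use range in \<open>force+\<close>)
  have "(\<lambda>n. D * ((\<Sum>k=1..K. c k * z k ^ Suc n) * (\<Sum>m=0..M. b m * real (Suc n) ^ m))
      + e * ((\<Sum>k=1..K. c k * inverse (z k) * z k ^ Suc n) * (\<Sum>m=0..M. b m * real (Suc n) ^ m))
      - (\<Sum>k=1..K. c k * a k * inverse (1 - z k) * z k ^ Suc n) * (\<Sum>m=0..M. b m * real (Suc n) ^ m))
    sums (D * (\<Sum>k=1..K. \<Sum>m=0..M. c k * b m * polylog (- int m) (z k))
      + e * (\<Sum>k=1..K. \<Sum>m=0..M. c k * inverse (z k) * b m * polylog (- int m) (z k))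
      - (\<Sum>k=1..K. \<Sum>m=0..M. c k * a k * inverse (1 - z k) * b m * polylog (- int m) (z k)))"
    by (intro sums_diff sums_add sums_mult S)
  then show ?thesis
    unfolding shift by (simp only: distrib_right left_diff_distrib mult.assoc mult.commute[of "b _" "inverse _"]
       mult.left_commute[of "b _" "inverse _"] add_diff_eq)
qed

text \<open>
  The second factor is of polynomial growth in \<open>n\<close>; it majorizes the excess of the
  cumulative reward in a state of an axis over that in the origin.
\<close>

lemma summable_axis:
  assumes range: "\<And>k. k \<in> {1..K} \<Longrightarrow> 0 < z k \<and> z k < (1::real)"
    and pos: "\<And>n. 0 \<le> (\<Sum>k=1..K. c k * z k ^ Suc n)"
  shows "summable (\<lambda>n. (\<Sum>k=1..K. c k * z k ^ Suc n) * (B + (\<Sum>j\<in>{1..n}. \<Sum>m=0..M. b m * real j ^ m)))"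
proof (rule summable_comparison_test')
  show "summable (\<lambda>n. (\<Sum>k=1..K. c k * z k ^ Suc n) *
      (\<Sum>m=0..Suc M. (if m = 0 then \<bar>B\<bar> else \<bar>b (m - 1)\<bar>) * real (Suc n) ^ m))"
    using sums_polynomial_geometric[OF range] by (rule sums_summable)
  fix n
  have "\<bar>\<Sum>j\<in>{1..n}. \<Sum>m=0..M. b m * real j ^ m\<bar> \<le> (\<Sum>j\<in>{1..n}. \<Sum>m=0..M. \<bar>b m\<bar> * real (Suc n) ^ m)"
  proof (rule order.trans[OF sum_abs], rule sum_mono, rule order.trans[OF sum_abs], rule sum_mono)
    fix j m assume "j \<in> {1..n}"
    then show "\<bar>b m * real j ^ m\<bar> \<le> \<bar>b m\<bar> * real (Suc n) ^ m"
      by (auto simp: abs_mult intro!: mult_left_mono power_mono)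
  qed
  also have "\<dots> = real n * (\<Sum>m=0..M. \<bar>b m\<bar> * real (Suc n) ^ m)" by simp
  also have "\<dots> \<le> real (Suc n) * (\<Sum>m=0..M. \<bar>b m\<bar> * real (Suc n) ^ m)"
    by (intro mult_right_mono sum_nonneg) auto
  also have "\<dots> = (\<Sum>m=0..M. \<bar>b m\<bar> * real (Suc n) ^ Suc m)"
    by (simp add: sum_distrib_left mult.left_commute del: of_nat_Suc)
  finally have "\<bar>B + (\<Sum>j\<in>{1..n}. \<Sum>m=0..M. b m * real j ^ m)\<bar>
      \<le> \<bar>B\<bar> + (\<Sum>m=0..M. \<bar>b m\<bar> * real (Suc n) ^ Suc m)" by linarith
  also have "\<dots> = (\<Sum>m=0..Suc M. (if m = 0 then \<bar>B\<bar> else \<bar>b (m - 1)\<bar>) * real (Suc n) ^ m)"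
    by (subst sum.atLeast0_atMost_Suc_shift) simp
  finally show "norm ((\<Sum>k=1..K. c k * z k ^ Suc n) * (B + (\<Sum>j\<in>{1..n}. \<Sum>m=0..M. b m * real j ^ m)))
    \<le> (\<Sum>k=1..K. c k * z k ^ Suc n) *
      (\<Sum>m=0..Suc M. (if m = 0 then \<bar>B\<bar> else \<bar>b (m - 1)\<bar>) * real (Suc n) ^ m)"
    using pos[of n] by (simp add: abs_mult mult_left_mono del: power_Suc of_nat_Suc)
qed

lemma has_sum_boundary:
  fixes f :: "state \<Rightarrow> real"
  assumes h: "(\<lambda>n. f (Suc n, 0)) sums H" and v: "(\<lambda>n. f (0, Suc n)) sums V"
    and interior: "\<And>a b. f (Suc a, Suc b) = 0" and pos: "\<And>x. 0 \<le> f x"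
  shows "(f has_sum H + V + f (0, 0)) UNIV"
proof -
  let ?h = "\<lambda>n. (Suc n, 0 :: nat)" and ?v = "\<lambda>n. (0 :: nat, Suc n)"
  have "(f has_sum H) (range ?h)" "(f has_sum V) (range ?v)"
    using sums_nonneg_imp_has_sum[OF h] sums_nonneg_imp_has_sum[OF v] pos
    by (simp_all add: has_sum_reindex inj_on_def o_def)
  then have "(f has_sum H + V) (range ?h \<union> range ?v)"
    by (rule has_sum_Un_disjoint) auto
  moreover have "(f has_sum f (0, 0)) {(0, 0)}"
    using has_sum_finite[of "{(0, 0)}" f] by simp
  ultimately have "(f has_sum H + V + f (0, 0)) (range ?h \<union> range ?v \<union> {(0, 0)})"
    by (rule has_sum_Un_disjoint) auto
  moreover have "x \<in> range ?h \<union> range ?v \<union> {(0, 0)} \<or> f x = 0" for x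
    by (cases x; cases "fst x"; cases "snd x") (auto simp: interior)
  ultimately show ?thesis
    using has_sum_cong_neutral[of UNIV "range ?h \<union> range ?v \<union> {(0, 0)}" f f] by blast
qed

section \<open>The error bound\<close>

lemma homogeneous_walk_simps:
  "homogeneous_walk h v r q (Suc a, Suc b) (i, j) = q i j"
  "homogeneous_walk h v r q (Suc a, 0) (i, j) = h i j"
  "homogeneous_walk h v r q (0, Suc a) (i, j) = v i j"
  "homogeneous_walk h v r q (0, 0) (i, j) = r i j"
  by (simp_all add: homogeneous_walk_def quadrant_walk_def)

lemma (in uniformized_walk) one_step_difference:
  assumes "\<And>d. d \<in> nbr x \<Longrightarrow> w' x d \<noteq> w x d \<Longrightarrow> \<bar>f (move x d) - f x\<bar> \<le> B"
  shows "\<bar>one_step \<gamma> w' f x - one_step \<gamma> w f x\<bar> \<le> (\<Sum>d\<in>nbr x. \<bar>w' x d - w x d\<bar>) * B / \<gamma>"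
proof -
  have "one_step \<gamma> w' f x - one_step \<gamma> w f x = (\<Sum>d\<in>nbr x. (w' x d - w x d) * (f (move x d) - f x)) / \<gamma>"
    by (simp add: one_step_eq left_diff_distrib sum_subtractf diff_divide_distrib)
  moreover have "\<bar>\<Sum>d\<in>nbr x. (w' x d - w x d) * (f (move x d) - f x)\<bar> \<le> (\<Sum>d\<in>nbr x. \<bar>w' x d - w x d\<bar> * B)"
  proof (rule order.trans[OF sum_abs], rule sum_mono)
    fix d assume "d \<in> nbr x"
    with assms[of d] show "\<bar>(w' x d - w x d) * (f (move x d) - f x)\<bar> \<le> \<bar>w' x d - w x d\<bar> * B"
      by (cases "w' x d = w x d") (auto simp: abs_mult intro: mult_left_mono)
  qed
  ultimately show ?thesis
    using \<gamma>_pos by (simp add: sum_distrib_right divide_right_mono)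
qed

text \<open>Both means, multiplied by \<open>t\<close>, are close to the same number \<open>R t z\<close>.\<close>

lemma (in reward_walk) abs_mean_difference_le:
  assumes "reward_comparison \<gamma> w F z C wb p A b G" "reward_comparison \<gamma> w F z C wb' p' A' b' G'"
  shows "\<bar>expected_reward p F - expected_reward p' F\<bar> \<le> expected_reward p G + expected_reward p' G'"
proof (rule field_le_epsilon)
  fix \<epsilon> :: real assume "0 < \<epsilon>"
  then have \<epsilon>: "0 < \<epsilon>/2" by simp
  let ?m = "expected_reward p F" and ?m' = "expected_reward p' F"
  let ?g = "expected_reward p G" and ?g' = "expected_reward p' G'"
  obtain D where D: "\<And>t. \<bar>real t * ?m - R t z\<bar> \<le> real t * (?g + \<epsilon>/2) + D"
    using reward_comparison.mean_growth[OF assms(1) \<epsilon>] by blast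
  obtain D' where D': "\<And>t. \<bar>real t * ?m' - R t z\<bar> \<le> real t * (?g' + \<epsilon>/2) + D'"
    using reward_comparison.mean_growth[OF assms(2) \<epsilon>] by blast
  show "\<bar>?m - ?m'\<bar> \<le> ?g + ?g' + \<epsilon>"
  proof (rule le_of_linear_bound)
    fix t
    have "real t * \<bar>?m - ?m'\<bar> = \<bar>real t * ?m - real t * ?m'\<bar>"
      by (simp add: abs_mult flip: right_diff_distrib)
    also have "\<dots> \<le> real t * (?g + \<epsilon>/2) + D + (real t * (?g' + \<epsilon>/2) + D')"
      using D[of t] D'[of t] by linarith
    finally show "real t * \<bar>?m - ?m'\<bar> \<le> real t * (?g + ?g' + \<epsilon>) + (D + D')"
      by (simp add: algebra_simps)
  qed
qed

locale boundary_perturbation = geometric_construction +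
  fixes h v r :: "int \<Rightarrow> int \<Rightarrow> real" and \<gamma> :: real and F :: "state \<Rightarrow> real"
    and M :: nat and b1 b2 :: "nat \<Rightarrow> real" and B3 :: real
  assumes rates_nonneg: "nonneg_rates (homogeneous_walk h v r q)"
    and h10_nonneg: "0 \<le> h10" and v01_nonneg: "0 \<le> v01"
    and h_left: "\<And>n. 1 \<le> n \<Longrightarrow> h (-1) 0 \<le> left n"
    and v_down: "\<And>n. 1 \<le> n \<Longrightarrow> v 0 (-1) \<le> down n"
    and unif: "uniformization_constant \<gamma> (homogeneous_walk h v r q)"
    and unif_bar: "uniformization_constant \<gamma> wb"
    and F_nonneg: "\<And>x. 0 \<le> F x"
    and bias_horizontal: "\<And>t n d. 1 \<le> n \<Longrightarrow> d \<in> N1 \<Longrightarrow>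
          \<bar>bias \<gamma> (homogeneous_walk h v r q) F t d (n, 0)\<bar> \<le> (\<Sum>m=0..M. b1 m * real n ^ m)"
    and bias_vertical: "\<And>t n d. 1 \<le> n \<Longrightarrow> d \<in> N2 \<Longrightarrow>
          \<bar>bias \<gamma> (homogeneous_walk h v r q) F t d (0, n)\<bar> \<le> (\<Sum>m=0..M. b2 m * real n ^ m)"
    and bias_origin: "\<And>t d. d \<in> N3 \<Longrightarrow>
          \<bar>bias \<gamma> (homogeneous_walk h v r q) F t d (0, 0)\<bar> \<le> B3"
begin

abbreviation "w \<equiv> homogeneous_walk h v r q"
abbreviation "B1 n \<equiv> (\<Sum>m=0..M. b1 m * real n ^ m)"
abbreviation "B2 n \<equiv> (\<Sum>m=0..M. b2 m * real n ^ m)"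

lemma rates: "d \<in> nbr x \<Longrightarrow> 0 \<le> w x d"
  using rates_nonneg unfolding nonneg_rates_def by blast

lemma q_nonneg: "(i, j) \<in> N4 \<Longrightarrow> 0 \<le> q i j"
  using rates[of "(i, j)" "(Suc 0, Suc 0)"] by (simp add: nbr_eq homogeneous_walk_simps)

lemma nonneg_bar: "nonneg_rates wb"
  unfolding nonneg_rates_def
proof (intro allI ballI)
  fix x d assume d: "d \<in> nbr x"
  have left0: "0 \<le> left (Suc a)" for a
    using h_left[of "Suc a"] rates[of "(-1, 0)" "(Suc 0, 0)"]
    by (simp add: nbr_eq steps_explicit homogeneous_walk_simps)
  have down0: "0 \<le> down (Suc a)" for a
    using v_down[of "Suc a"] rates[of "(0, -1)" "(0, Suc 0)"]
    by (simp add: nbr_eq steps_explicit homogeneous_walk_simps)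
  note q0 = q_nonneg[unfolded steps_explicit]
  obtain m n where x: "x = (m, n)" by (cases x)
  show "0 \<le> wb x d"
    using d unfolding x
    by (cases m; cases n)
       (auto simp: nbr_eq steps_explicit wb_simps left0 down0 h10_nonneg v01_nonneg intro!: q0)
qed

sublocale W: uniformized_walk \<gamma> w
  by unfold_locales (rule rates_nonneg, rule unif)

sublocale Wb: stationary_walk \<gamma> wb p
  by unfold_locales (rule nonneg_bar, rule unif_bar, rule stationary_geometric_sum)

lemma B_nonneg: "1 \<le> n \<Longrightarrow> 0 \<le> B1 n" "1 \<le> n \<Longrightarrow> 0 \<le> B2 n" "0 \<le> B3"
proof -
  show "1 \<le> n \<Longrightarrow> 0 \<le> B1 n"
    using bias_horizontal[of n "(1, 0)" 0] by (simp add: steps_explicit bias_def)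
  show "1 \<le> n \<Longrightarrow> 0 \<le> B2 n"
    using bias_vertical[of n "(1, 0)" 0] by (simp add: steps_explicit bias_def)
  show "0 \<le> B3"
    using bias_origin[of "(1, 0)" 0] by (simp add: steps_explicit bias_def)
qed

sublocale RW: reward_walk \<gamma> w F "(0, 0)" "F (0, 0) + B3"
proof unfold_locales
  show "0 \<le> F x" for x by (rule F_nonneg)
  fix t
  let ?R = "cumulative_reward \<gamma> w F t"
  have "(\<Sum>d\<in>nbr (0, 0). w (0, 0) d * (?R (move (0, 0) d) - ?R (0, 0)))
      \<le> (\<Sum>d\<in>nbr (0, 0). w (0, 0) d * B3)"
  proof (intro sum_mono mult_left_mono rates)
    fix d assume "d \<in> nbr (0, 0)"
    then have "\<bar>bias \<gamma> w F t d (0, 0)\<bar> \<le> B3" by (intro bias_origin) (simp add: nbr_eq)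
    then show "?R (move (0, 0) d) - ?R (0, 0) \<le> B3" by (simp add: bias_def abs_le_iff)
  qed
  also have "\<dots> \<le> \<gamma> * B3"
    unfolding sum_distrib_right[symmetric] exit_rate_def[symmetric]
    by (intro mult_right_mono W.exit_rate_le B_nonneg)
  finally have "(\<Sum>d\<in>nbr (0, 0). w (0, 0) d * (?R (move (0, 0) d) - ?R (0, 0))) / \<gamma> \<le> B3"
    using W.\<gamma>_pos by (simp add: divide_le_eq mult.commute)
  then show "cumulative_reward \<gamma> w F (Suc t) (0, 0) \<le> ?R (0, 0) + (F (0, 0) + B3)"
    unfolding cumulative_reward_Suc one_step_eq by linarith
qed

definition bias_bound :: "state \<Rightarrow> real" where
  "bias_bound x = (if snd x = 0 then if fst x = 0 then B3 else B1 (fst x)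
    else if fst x = 0 then B2 (snd x) else 0)"

definition rate_change :: "state \<Rightarrow> real" where
  "rate_change x = (\<Sum>d\<in>nbr x. \<bar>wb x d - w x d\<bar>)"

lemma agree: "0 < fst x \<Longrightarrow> 0 < snd x \<Longrightarrow> wb x d = w x d"
  by (cases x; cases "fst x"; cases "snd x"; cases d) (auto simp: wb_simps homogeneous_walk_simps)

lemma bias_bound_nonneg: "0 \<le> bias_bound x"
  using B_nonneg(1)[of "fst x"] B_nonneg(2)[of "snd x"] B_nonneg(3)
  by (simp add: bias_bound_def Suc_le_eq)

lemma bias_le_bias_bound:
  assumes "d \<in> nbr x" "wb x d \<noteq> w x d"
  shows "\<bar>RW.R t (move x d) - RW.R t x\<bar> \<le> bias_bound x"
proof -
  obtain m n where x: "x = (m, n)" by (cases x)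
  have "m = 0 \<or> n = 0" using agree[of x d] assms(2) by (auto simp: x)
  then show ?thesis
    using assms(1) bias_horizontal[of m d t] bias_vertical[of n d t] bias_origin[of d t]
    by (cases m; cases n) (simp_all add: x nbr_eq bias_bound_def bias_def)
qed

text \<open>
  The hypothesis on the inhomogeneous rate removes the absolute value from the change of the step
  \<open>(-1, 0)\<close>, which makes the sum over the axis computable.
\<close>

lemma rate_change_horizontal: "rate_change (Suc n, 0)
  = (delta_h q h + \<bar>h10 - h 1 0\<bar> - h (-1) 0) + left (Suc n)"
  using h_left[of "Suc n"]
  by (simp add: rate_change_def nbr_eq steps_explicit wb_simps homogeneous_walk_simps delta_h_def unit_steps)

lemma rate_change_vertical: "rate_change (0, Suc n)
  = (delta_v q v + \<bar>v01 - v 0 1\<bar> - v 0 (-1)) + down (Suc n)"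
  using v_down[of "Suc n"]
  by (simp add: rate_change_def nbr_eq steps_explicit wb_simps homogeneous_walk_simps delta_v_def unit_steps)

lemma rate_change_origin: "rate_change (0, 0) = delta_r q r h10 v01"
  by (simp add: rate_change_def nbr_eq steps_explicit wb_simps homogeneous_walk_simps delta_r_def bar_r_def)

definition error_bound :: real where
  "error_bound =
      ((delta_h q h + \<bar>h10 - h 1 0\<bar> - h (-1) 0)
          * (\<Sum>k=1..K. \<Sum>m=0..M. c k * b1 m * polylog (- int m) (\<rho> k))
        + h10 * (\<Sum>k=1..K. \<Sum>m=0..M. c k * inverse (\<rho> k) * b1 m * polylog (- int m) (\<rho> k))
        - (\<Sum>k=1..K. \<Sum>m=0..M. c k * alpha q (\<rho> k) (\<sigma> k) * b1 m * inverse (1 - \<rho> k)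
            * polylog (- int m) (\<rho> k)))
    + ((delta_v q v + \<bar>v01 - v 0 1\<bar> - v 0 (-1))
          * (\<Sum>k=1..K. \<Sum>m=0..M. c k * b2 m * polylog (- int m) (\<sigma> k))
        + v01 * (\<Sum>k=1..K. \<Sum>m=0..M. c k * inverse (\<sigma> k) * b2 m * polylog (- int m) (\<sigma> k))
        - (\<Sum>k=1..K. \<Sum>m=0..M. c k * beta q (\<rho> k) (\<sigma> k) * b2 m * inverse (1 - \<sigma> k)
            * polylog (- int m) (\<sigma> k)))
    + delta_r q r h10 v01 * B3 * (\<Sum>k=1..K. c k)"

lemma p_axes: "p (n, 0) = (\<Sum>k=1..K. c k * \<rho> k ^ n)" "p (0, n) = (\<Sum>k=1..K. c k * \<sigma> k ^ n)"
  by (simp_all add: geometric_sum_def)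

lemma has_sum_error_bound:
  "((\<lambda>x. p x * (rate_change x * bias_bound x)) has_sum error_bound) UNIV"
proof -
  let ?f = "\<lambda>x. p x * (rate_change x * bias_bound x)"
  have "?f (Suc n, 0) = ((delta_h q h + \<bar>h10 - h 1 0\<bar> - h (-1) 0) * (\<Sum>k=1..K. c k * \<rho> k ^ Suc n)
      + (h10 * (\<Sum>k=1..K. c k * \<rho> k ^ n)
        - (\<Sum>k=1..K. c k * alpha q (\<rho> k) (\<sigma> k) * inverse (1 - \<rho> k) * \<rho> k ^ Suc n))) * B1 (Suc n)" for n
  proof -
    have "?f (Suc n, 0) = ((delta_h q h + \<bar>h10 - h 1 0\<bar> - h (-1) 0) * p (Suc n, 0)
        + p (Suc n, 0) * left (Suc n)) * B1 (Suc n)"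
      unfolding rate_change_horizontal by (simp add: bias_bound_def algebra_simps)
    then show ?thesis unfolding left_flow unfolding p_axes .
  qed
  then have H: "(\<lambda>n. ?f (Suc n, 0)) sums
      ((delta_h q h + \<bar>h10 - h 1 0\<bar> - h (-1) 0)
          * (\<Sum>k=1..K. \<Sum>m=0..M. c k * b1 m * polylog (- int m) (\<rho> k))
        + h10 * (\<Sum>k=1..K. \<Sum>m=0..M. c k * inverse (\<rho> k) * b1 m * polylog (- int m) (\<rho> k))
        - (\<Sum>k=1..K. \<Sum>m=0..M. c k * alpha q (\<rho> k) (\<sigma> k) * b1 m * inverse (1 - \<rho> k)
            * polylog (- int m) (\<rho> k)))"
    by (simp only:) (rule axis_sums, use range in auto)
  have "?f (0, Suc n) = ((delta_v q v + \<bar>v01 - v 0 1\<bar> - v 0 (-1)) * (\<Sum>k=1..K. c k * \<sigma> k ^ Suc n)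
      + (v01 * (\<Sum>k=1..K. c k * \<sigma> k ^ n)
        - (\<Sum>k=1..K. c k * beta q (\<rho> k) (\<sigma> k) * inverse (1 - \<sigma> k) * \<sigma> k ^ Suc n))) * B2 (Suc n)" for n
  proof -
    have "?f (0, Suc n) = ((delta_v q v + \<bar>v01 - v 0 1\<bar> - v 0 (-1)) * p (0, Suc n)
        + p (0, Suc n) * down (Suc n)) * B2 (Suc n)"
      unfolding rate_change_vertical by (simp add: bias_bound_def algebra_simps)
    then show ?thesis unfolding down_flow unfolding p_axes .
  qed
  then have V: "(\<lambda>n. ?f (0, Suc n)) sums
      ((delta_v q v + \<bar>v01 - v 0 1\<bar> - v 0 (-1))
          * (\<Sum>k=1..K. \<Sum>m=0..M. c k * b2 m * polylog (- int m) (\<sigma> k))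
        + v01 * (\<Sum>k=1..K. \<Sum>m=0..M. c k * inverse (\<sigma> k) * b2 m * polylog (- int m) (\<sigma> k))
        - (\<Sum>k=1..K. \<Sum>m=0..M. c k * beta q (\<rho> k) (\<sigma> k) * b2 m * inverse (1 - \<sigma> k)
            * polylog (- int m) (\<sigma> k)))"
    by (simp only:) (rule axis_sums, use range in auto)
  have pos: "0 \<le> ?f x" for x
    by (intro mult_nonneg_nonneg Wb.p_nonneg bias_bound_nonneg) (simp add: rate_change_def sum_nonneg)
  have O: "?f (0, 0) = delta_r q r h10 v01 * B3 * (\<Sum>k=1..K. c k)"
    by (simp add: rate_change_origin bias_bound_def geometric_sum_def)
  show ?thesis
    unfolding error_bound_def O[symmetric]
    by (rule has_sum_boundary[OF H V _ pos]) (simp add: bias_bound_def)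
qed

definition axis_bound :: "state \<Rightarrow> real" where
  "axis_bound x = B3 + (if snd x = 0 then \<Sum>j\<in>{1..fst x - 1}. B1 j else \<Sum>j\<in>{1..snd x - 1}. B2 j)"

lemma axis_bound_nonneg: "0 \<le> axis_bound x"
  unfolding axis_bound_def by (auto intro!: add_nonneg_nonneg sum_nonneg B_nonneg)

text \<open>The bias terms along an axis add up.\<close>

lemma R_le_axis_bound:
  assumes "fst x = 0 \<or> snd x = 0"
  shows "RW.R t x \<le> RW.R t (0, 0) + axis_bound x"
proof -
  have horizontal: "RW.R t (Suc n, 0) \<le> RW.R t (0, 0) + axis_bound (Suc n, 0)" for n
  proof (induction n)
    case 0
    show ?case using bias_origin[of "(1, 0)" t]
      by (simp add: steps_explicit bias_def move_steps axis_bound_def abs_le_iff)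
  next
    case (Suc n)
    have "RW.R t (Suc (Suc n), 0) \<le> RW.R t (Suc n, 0) + B1 (Suc n)"
      using bias_horizontal[of "Suc n" "(1, 0)" t]
      by (simp add: steps_explicit bias_def move_steps abs_le_iff del: of_nat_Suc)
    with Suc show ?case by (simp add: axis_bound_def)
  qed
  have vertical: "RW.R t (0, Suc n) \<le> RW.R t (0, 0) + axis_bound (0, Suc n)" for n
  proof (induction n)
    case 0
    show ?case using bias_origin[of "(0, 1)" t]
      by (simp add: steps_explicit bias_def move_steps axis_bound_def abs_le_iff)
  next
    case (Suc n)
    have "RW.R t (0, Suc (Suc n)) \<le> RW.R t (0, Suc n) + B2 (Suc n)"
      using bias_vertical[of "Suc n" "(0, 1)" t]
      by (simp add: steps_explicit bias_def move_steps abs_le_iff del: of_nat_Suc)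
    with Suc show ?case by (simp add: axis_bound_def)
  qed
  show ?thesis
    using assms horizontal vertical axis_bound_nonneg[of "(0, 0)"]
    by (cases x; cases "fst x"; cases "snd x") auto
qed

lemma axis_bound_finite: "finite_mean p (\<lambda>x. if x \<in> {x. fst x = 0 \<or> snd x = 0} then axis_bound x else 0)"
proof -
  let ?f = "\<lambda>x. p x * (if x \<in> {x. fst x = 0 \<or> snd x = 0} then axis_bound x else 0)"
  have "summable (\<lambda>n. ?f (Suc n, 0))"
    using summable_axis[of K \<rho> c B3 b1 M] range Wb.p_nonneg[of "(Suc n, 0)" for n]
    by (simp add: p_axes axis_bound_def)
  moreover have "summable (\<lambda>n. ?f (0, Suc n))"
    using summable_axis[of K \<sigma> c B3 b2 M] range Wb.p_nonneg[of "(0, Suc n)" for n]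
    by (simp add: p_axes axis_bound_def)
  ultimately have "(?f has_sum (\<Sum>n. ?f (Suc n, 0)) + (\<Sum>n. ?f (0, Suc n)) + ?f (0, 0)) UNIV"
    by (intro has_sum_boundary summable_sums) (auto simp: Wb.p_nonneg axis_bound_nonneg)
  then show ?thesis by (rule has_sum_imp_summable)
qed

theorem reward_error:
  assumes irr: "irreducible_walk w" and stat: "stationary_distribution w \<pi>"
  shows "\<bar>expected_reward p F - expected_reward \<pi> F\<bar> \<le> error_bound / \<gamma>"
proof -
  interpret W\<pi>: stationary_walk \<gamma> w \<pi>
    by unfold_locales (rule stat)
  have recurrent: "(\<lambda>n. avoidance_prob \<gamma> w {(0, 0)} n x) \<longlonglongrightarrow> 0" for x
    by (rule W\<pi>.avoidance_prob_tendsto_0[OF irr]) simp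
  let ?G = "\<lambda>x. rate_change x * bias_bound x / \<gamma>"
  have G: "((\<lambda>x. p x * ?G x) has_sum error_bound / \<gamma>) UNIV"
    using has_sum_cmult_left[OF has_sum_error_bound, of "inverse \<gamma>"]
    by (simp add: divide_inverse mult.assoc)
  have "reward_comparison \<gamma> w F (0, 0) (F (0, 0) + B3) wb p {x. fst x = 0 \<or> snd x = 0} axis_bound ?G"
  proof unfold_locales
    show "\<bar>one_step \<gamma> wb (RW.R t) x - one_step \<gamma> w (RW.R t) x\<bar> \<le> ?G x" for t x
      unfolding rate_change_def by (rule W.one_step_difference) (rule bias_le_bias_bound)
    show "finite_mean p ?G" using G by (rule has_sum_imp_summable)
  qed (auto simp: recurrent agree axis_bound_nonneg R_le_axis_bound axis_bound_finite[simplified])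
  \<comment> \<open>The walk compared with itself: the set may shrink to the origin, where \<open>R t\<close> equals \<open>R t (0, 0)\<close>.\<close>
  moreover have "reward_comparison \<gamma> w F (0, 0) (F (0, 0) + B3) w \<pi> {(0, 0)} (\<lambda>_. 0) (\<lambda>_. 0)"
    by unfold_locales (auto simp: recurrent)
  ultimately have "\<bar>expected_reward p F - expected_reward \<pi> F\<bar>
      \<le> expected_reward p ?G + expected_reward \<pi> (\<lambda>_. 0)"
    by (rule RW.abs_mean_difference_le)
  then show ?thesis
    using infsumI[OF G] by (simp add: expected_reward_def)
qed

lemma error_bound_nonneg: "0 \<le> error_bound"
  by (rule has_sum_nonneg[OF has_sum_error_bound])
     (intro mult_nonneg_nonneg Wb.p_nonneg bias_bound_nonneg, simp add: rate_change_def sum_nonneg)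

end

theorem theorem4p2:
  fixes h v r q :: "int \<Rightarrow> int \<Rightarrow> real"
    and \<pi> :: "nat \<times> nat \<Rightarrow> real"
    and K :: nat and c \<rho> \<sigma> :: "nat \<Rightarrow> real"
    and h10 v01 \<gamma> :: real
    and F :: "nat \<times> nat \<Rightarrow> real"
    and M :: nat and b1 b2 :: "nat \<Rightarrow> real" and B3 :: real
  assumes rates_nonneg: "nonneg_rates (homogeneous_walk h v r q)"
    and irreducible: "irreducible_walk (homogeneous_walk h v r q)"
    and aperiodic: "aperiodic_walk (homogeneous_walk h v r q)"
    and positive_recurrent: "positive_recurrent_walk (homogeneous_walk h v r q)"
    and stationary: "stationary_distribution (homogeneous_walk h v r q) \<pi>"
    and q00: "q 0 0 = - (\<Sum>(i, j)\<in>N4. q i j)"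
    and geometric_range: "\<And>k. k \<in> {1..K} \<Longrightarrow> \<rho> k \<in> {0<..<1} \<and> \<sigma> k \<in> {0<..<1}"
    and geometric_distribution: "prob_distribution (geometric_sum K c \<rho> \<sigma>)"
    and geometric_balance: "\<And>k. k \<in> {1..K} \<Longrightarrow> interior_balance q (\<rho> k) (\<sigma> k)"
    and h10_nonneg: "0 \<le> h10" and v01_nonneg: "0 \<le> v01"
    and well_defined: "construction_well_defined K c \<rho> \<sigma>"
    and h_left: "\<And>n. 1 \<le> n \<Longrightarrow> bar_h_left K c \<rho> \<sigma> q h10 n \<ge> h (-1) 0"
    and v_down: "\<And>n. 1 \<le> n \<Longrightarrow> bar_v_down K c \<rho> \<sigma> q v01 n \<ge> v 0 (-1)"
    and uniformizable: "uniformization_constant \<gamma> (homogeneous_walk h v r q)"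
    and uniformizable_bar: "uniformization_constant \<gamma> (bar_walk K c \<rho> \<sigma> q h10 v01)"
    and \<gamma>_ge_1: "1 \<le> \<gamma>"
    and F_nonneg: "\<And>x. 0 \<le> F x"
    and bias_horizontal: "\<And>t n d. 1 \<le> n \<Longrightarrow> d \<in> N1 \<Longrightarrow>
          \<bar>bias \<gamma> (homogeneous_walk h v r q) F t d (n, 0)\<bar> \<le> (\<Sum>m=0..M. b1 m * real n ^ m)"
    and bias_vertical: "\<And>t n d. 1 \<le> n \<Longrightarrow> d \<in> N2 \<Longrightarrow>
          \<bar>bias \<gamma> (homogeneous_walk h v r q) F t d (0, n)\<bar> \<le> (\<Sum>m=0..M. b2 m * real n ^ m)"
    and bias_origin: "\<And>t d. d \<in> N3 \<Longrightarrow>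
          \<bar>bias \<gamma> (homogeneous_walk h v r q) F t d (0, 0)\<bar> \<le> B3"
  shows "\<bar>expected_reward (geometric_sum K c \<rho> \<sigma>) F - expected_reward \<pi> F\<bar> \<le>
      ((delta_h q h + \<bar>h10 - h 1 0\<bar> - h (-1) 0)
          * (\<Sum>k=1..K. \<Sum>m=0..M. c k * b1 m * polylog (- int m) (\<rho> k))
        + h10 * (\<Sum>k=1..K. \<Sum>m=0..M. c k * inverse (\<rho> k) * b1 m * polylog (- int m) (\<rho> k))
        - (\<Sum>k=1..K. \<Sum>m=0..M. c k * alpha q (\<rho> k) (\<sigma> k) * b1 m * inverse (1 - \<rho> k)
            * polylog (- int m) (\<rho> k)))
    + ((delta_v q v + \<bar>v01 - v 0 1\<bar> - v 0 (-1))
          * (\<Sum>k=1..K. \<Sum>m=0..M. c k * b2 m * polylog (- int m) (\<sigma> k))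
        + v01 * (\<Sum>k=1..K. \<Sum>m=0..M. c k * inverse (\<sigma> k) * b2 m * polylog (- int m) (\<sigma> k))
        - (\<Sum>k=1..K. \<Sum>m=0..M. c k * beta q (\<rho> k) (\<sigma> k) * b2 m * inverse (1 - \<sigma> k)
            * polylog (- int m) (\<sigma> k)))
    + delta_r q r h10 v01 * B3 * (\<Sum>k=1..K. c k)"
proof -
  interpret boundary_perturbation K c \<rho> \<sigma> q h10 v01 h v r \<gamma> F M b1 b2 B3
    by unfold_locales (fact assms)+
  have "\<bar>expected_reward (geometric_sum K c \<rho> \<sigma>) F - expected_reward \<pi> F\<bar> \<le> error_bound / \<gamma>"
    using irreducible stationary by (rule reward_error)
  \<comment> \<open>The bound is stated in terms of rates, the chain moves with the rates divided by \<open>\<gamma>\<close>.\<close>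
  also have "\<dots> \<le> error_bound"
    using error_bound_nonneg \<gamma>_ge_1 by (simp add: divide_le_eq mult_le_cancel_left1)
  finally show ?thesis unfolding error_bound_def .
qed

end
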